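(* Let $\alpha\in[0,1)$, $p\in(0,1]$, and $\tau=\frac{\sqrt{1-\alpha}}{L}\gamma$ with $\gamma\in(0,1)$. Then for the sequences generated by FBF with variance reduction (described in the context) and any $\mathbf z_*\in\mathsf{Sol}$, it holds for every $k\ge0$ that $$\mathbb E_k\left[\Phi_{k+1}(\mathbf z_* )\right]\le\Phi_k(\mathbf z_* ),$$ where $\Phi_k(\mathbf z)=\alpha\|\mathbf z_k-\mathbf z\|^2+\frac{1-\alpha}{p}\|\mathbf w_k-\mathbf z\|^2$. Moreover, if $F_\xi$ is continuous for all $\xi$, then $(\mathbf z_k)$ converges almost surely to some $\mathbf z_*\in\mathsf{Sol}$.
   Context: Let $\mathcal Z$ be a finite-dimensional vector space with Euclidean inner product $\langle\cdot,\cdot\rangle$ and norm $\|\cdot\|$. Monotone inclusion problem: find $\mathbf z_*\in\mathcal Z$ such that $0\in(F+G)(\mathbf z_* )$. Assumptions: the solution set $\mathsf{Sol}=(F+G)^{-1}(0)$ is nonempty; the operators $G:\mathcal Z\rightrightarrows\mathcal Z$ and $F:\mathcal Z\to\mathcal Z$ are maximally monotone; $F$ has a stochastic oracle $F_\xi$ ($\xi$ with distribution $Q$) that is unbiased, $F(\mathbf z)=\mathbb E_\xi[F_\xi(\mathbf z)]$, and $L$-Lipschitz in mean ($L>0$): $\mathbb E_\xi\|F_\xi(\mathbf u)-F_\xi(\mathbf v)\|^2\le L^2\|\mathbf u-\mathbf v\|^2$ for all $\mathbf u,\mathbf v\in\mathcal Z$. The resolvent is $J_G=(I+G)^{-1}$.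 FBF with variance reduction: given deterministic $\mathbf z_0=\mathbf w_0$, for $k=0,1,\dots$: $\bar{\mathbf z}_k=\alpha\mathbf z_k+(1-\alpha)\mathbf w_k$; $\mathbf z_{k+1/2}=J_{\tau G}(\bar{\mathbf z}_k-\tau F(\mathbf w_k))$; draw $\xi_k\sim Q$ (independently of the past); $\mathbf z_{k+1}=\mathbf z_{k+1/2}-\tau(F_{\xi_k}(\mathbf z_{k+1/2})-F_{\xi_k}(\mathbf w_k))$; $\mathbf w_{k+1}=\mathbf z_{k+1}$ with probability $p$ and $\mathbf w_{k+1}=\mathbf w_k$ with probability $1-p$ (independently of everything else). $\mathbb E_k[\cdot]$ denotes the conditional expectation given $\sigma(\xi_0,\dots,\xi_{k-1},\mathbf w_0,\dots,\mathbf w_k)$. *)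

theory Defs
  imports "HOL-Probability.Probability"
begin

section \<open>Set-valued operators\<close>

definition monotone_operator :: "('a::real_inner \<Rightarrow> 'a set) \<Rightarrow> bool" where
  "monotone_operator A \<longleftrightarrow>
     (\<forall>x y. \<forall>u\<in>A x. \<forall>v\<in>A y. 0 \<le> inner (u - v) (x - y))"

definition maximally_monotone :: "('a::real_inner \<Rightarrow> 'a set) \<Rightarrow> bool" where
  "maximally_monotone A \<longleftrightarrow> monotone_operator A \<and>
     (\<forall>B. monotone_operator B \<and> (\<forall>x. A x \<subseteq> B x) \<longrightarrow> B = A)"

definition single_valued_operator :: "('a \<Rightarrow> 'a) \<Rightarrow> 'a \<Rightarrow> 'a set" where
  "single_valued_operator f x = {f x}"

definition operator_sum :: "('a::plus \<Rightarrow> 'a set) \<Rightarrow> ('a \<Rightarrow> 'a set) \<Rightarrow> 'a \<Rightarrow> 'a set" where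
  "operator_sum A B x = {u + v | u v. u \<in> A x \<and> v \<in> B x}"

definition operator_scale :: "real \<Rightarrow> ('a::real_vector \<Rightarrow> 'a set) \<Rightarrow> 'a \<Rightarrow> 'a set" where
  "operator_scale t A x = (\<lambda>u. t *\<^sub>R u) ` A x"

definition operator_inverse :: "('a \<Rightarrow> 'a set) \<Rightarrow> 'a \<Rightarrow> 'a set" where
  "operator_inverse A y = {x. y \<in> A x}"

text \<open>The resolvent is kept set-valued. For a maximally monotone operator it has
  exactly one value at every point, so membership says the same as equality.\<close>

definition resolvent :: "('a::real_vector \<Rightarrow> 'a set) \<Rightarrow> 'a \<Rightarrow> 'a set" where
  "resolvent A = operator_inverse (operator_sum (single_valued_operator id) A)"

definition solution_set :: "('a::real_vector \<Rightarrow> 'a) \<Rightarrow> ('a \<Rightarrow> 'a set) \<Rightarrow> 'a set" where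
  "solution_set F G = operator_inverse (operator_sum (single_valued_operator F) G) 0"

section \<open>Stochastic oracles\<close>

text \<open>Joint measurability in the sample and the point makes the iterates random
  variables. The nonnegative integral in the Lipschitz condition
  forces the second moment to be finite.\<close>

definition lipschitz_in_mean_oracle ::
  "'s measure \<Rightarrow> ('s \<Rightarrow> 'a::euclidean_space \<Rightarrow> 'a) \<Rightarrow> ('a \<Rightarrow> 'a) \<Rightarrow> real \<Rightarrow> bool" where
  "lipschitz_in_mean_oracle Q F\<xi> F L \<longleftrightarrow>
     case_prod F\<xi> \<in> borel_measurable (Q \<Otimes>\<^sub>M borel) \<and>
     (\<forall>u. integrable Q (\<lambda>s. F\<xi> s u) \<and> F u = (\<integral>s. F\<xi> s u \<partial>Q)) \<and>
     (\<forall>u v. (\<integral>\<^sup>+ s. ennreal ((norm (F\<xi> s u - F\<xi> s v))\<^sup>2) \<partial>Q)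
              \<le> ennreal (L\<^sup>2 * (norm (u - v))\<^sup>2))"

section \<open>Forward-backward-forward with variance reduction\<close>

text \<open>The coin \<open>c k\<close> decides whether \<open>w (k + 1)\<close> is refreshed. Mutual independence
  of the pairs \<open>(\<xi> k, c k)\<close> over all \<open>k\<close>, together with the product law of each pair,
  says that \<open>\<xi> k\<close> has law \<open>Q\<close>, that \<open>c k\<close> is Bernoulli with parameter \<open>p\<close>, and that
  all samples and coins together are mutually independent.\<close>

definition fbf_randomness ::
  "'w measure \<Rightarrow> 's measure \<Rightarrow> real \<Rightarrow> (nat \<Rightarrow> 'w \<Rightarrow> 's) \<Rightarrow> (nat \<Rightarrow> 'w \<Rightarrow> bool) \<Rightarrow> bool" where
  "fbf_randomness M Q p \<xi> c \<longleftrightarrow>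
     prob_space.indep_vars M (\<lambda>_. Q \<Otimes>\<^sub>M count_space UNIV) (\<lambda>k \<omega>. (\<xi> k \<omega>, c k \<omega>)) UNIV \<and>
     (\<forall>k. distr M (Q \<Otimes>\<^sub>M count_space UNIV) (\<lambda>\<omega>. (\<xi> k \<omega>, c k \<omega>))
            = Q \<Otimes>\<^sub>M measure_pmf (bernoulli_pmf p))"

text \<open>\<open>zh k\<close> is the half step $z_{k+1/2}$.\<close>

definition fbf_iterates ::
  "'w measure \<Rightarrow> ('s \<Rightarrow> 'a::euclidean_space \<Rightarrow> 'a) \<Rightarrow> ('a \<Rightarrow> 'a) \<Rightarrow> ('a \<Rightarrow> 'a set) \<Rightarrow>
   real \<Rightarrow> real \<Rightarrow> 'a \<Rightarrow> (nat \<Rightarrow> 'w \<Rightarrow> 's) \<Rightarrow> (nat \<Rightarrow> 'w \<Rightarrow> bool) \<Rightarrow>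
   (nat \<Rightarrow> 'w \<Rightarrow> 'a) \<Rightarrow> (nat \<Rightarrow> 'w \<Rightarrow> 'a) \<Rightarrow> (nat \<Rightarrow> 'w \<Rightarrow> 'a) \<Rightarrow> bool" where
  "fbf_iterates M F\<xi> F G \<alpha> \<tau> z0 \<xi> c z zh w \<longleftrightarrow>
     (\<forall>\<omega>\<in>space M. z 0 \<omega> = z0 \<and> w 0 \<omega> = z0 \<and>
       (\<forall>k. (let zbar = \<alpha> *\<^sub>R z k \<omega> + (1 - \<alpha>) *\<^sub>R w k \<omega> in
               zh k \<omega> \<in> resolvent (operator_scale \<tau> G) (zbar - \<tau> *\<^sub>R F (w k \<omega>))) \<and>
            z (Suc k) \<omega> = zh k \<omega> - \<tau> *\<^sub>R (F\<xi> (\<xi> k \<omega>) (zh k \<omega>) - F\<xi> (\<xi> k \<omega>) (w k \<omega>)) \<and>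
            w (Suc k) \<omega> = (if c k \<omega> then z (Suc k) \<omega> else w k \<omega>)))"

text \<open>The sigma-algebra generated by $\xi_0,\dots,\xi_{k-1},w_0,\dots,w_k$.\<close>

definition fbf_history ::
  "'w measure \<Rightarrow> 's measure \<Rightarrow> (nat \<Rightarrow> 'w \<Rightarrow> 's) \<Rightarrow> (nat \<Rightarrow> 'w \<Rightarrow> 'a::euclidean_space) \<Rightarrow>
   nat \<Rightarrow> 'w measure" where
  "fbf_history M Q \<xi> w k = sigma (space M)
     ({\<xi> i -` A \<inter> space M | i A. i < k \<and> A \<in> sets Q} \<union>
      {w i -` B \<inter> space M | i B. i \<le> k \<and> B \<in> sets borel})"

definition lyapunov ::
  "real \<Rightarrow> real \<Rightarrow> (nat \<Rightarrow> 'w \<Rightarrow> 'a::euclidean_space) \<Rightarrow> (nat \<Rightarrow> 'w \<Rightarrow> 'a) \<Rightarrow>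
   nat \<Rightarrow> 'a \<Rightarrow> 'w \<Rightarrow> real" where
  "lyapunov \<alpha> p z w k x \<omega> =
     \<alpha> * (norm (z k \<omega> - x))\<^sup>2 + (1 - \<alpha>) / p * (norm (w k \<omega> - x))\<^sup>2"

end

theory Submission
  imports Defs
begin

text \<open>Fix the state $(z_k, w_k)$, the half step $h = z_{k+1/2}$ and a solution $x$. Monotonicity of $G$
compares $h$ with $x$, monotonicity of $F$ removes the inner product that is left, and the
stochastic correction costs at most
$\tau^2 L^2\|h-w_k\|^2 = (1-\alpha)\gamma^2\|h-w_k\|^2$, less than what the three-point identity
leaves over. Averaging over the independent sample and coin gives
\[ \mathbb E_k[\Phi_{k+1}(x)] + \alpha\|z_k-h\|^2 + (1-\alpha)(1-\gamma^2)\|w_k-h\|^2 \le \Phi_k(x) \]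
(\<open>\<Phi>_supermartingale\<close>), and this remains true when $x$ is a random solution that is known at
time $k$. Dropping the surplus is the first claim (\<open>\<Phi>_cond_exp_le\<close>).

For the convergence, the surplus terms have finite expected sum, so they tend to zero almost
surely, and so do the corrections $z_{k+1}-h$. Ville's maximal inequality bounds
$\Phi_k(x)$ over all $k$, so $(w_k)$ is almost surely bounded; by the closed graph of $G$ and the
continuity of $F$ all its cluster points are solutions (\<open>cluster_point_in_solution_set\<close>), and its
distance to the solution set vanishes.

That the sequence has only one cluster point is also taken from the maximal inequality. At time
$n$ choose measurably a solution $X_n$ that is almost closest to $w_n$. Then
$\Phi_n(X_n) \to 0$ almost surely, and the probability that $\Phi_k(X_n)$ exceeds a given level at some
later time $k$ is at most the mean of a truncation of $\Phi_n(X_n)$, so it tends to zero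
(\<open>AE_eventually_trapped\<close>). Hence almost surely, for each level there is an $n$ such that all later
reference points stay near $X_n$: $(w_k)$ is a Cauchy sequence.
Finally $z_{k+1}-w_k \to 0$ carries the limit over to $(z_k)$.\<close>

section \<open>Maximally monotone operators\<close>

lemma mem_resolvent_scale_iff:
  assumes "t \<noteq> 0"
  shows "u \<in> resolvent (operator_scale t A) y \<longleftrightarrow> (1 / t) *\<^sub>R (y - u) \<in> A u"
proof
  assume "u \<in> resolvent (operator_scale t A) y"
  then obtain g where "g \<in> A u" "y = u + t *\<^sub>R g"
    by (auto simp: resolvent_def operator_inverse_def operator_sum_def
        single_valued_operator_def operator_scale_def)
  then show "(1 / t) *\<^sub>R (y - u) \<in> A u" using assms by simp
next
  assume *: "(1 / t) *\<^sub>R (y - u) \<in> A u"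
  have "t *\<^sub>R ((1 / t) *\<^sub>R (y - u)) = y - u" using assms by simp
  then have "y - u \<in> (\<lambda>g. t *\<^sub>R g) ` A u" using * by (metis imageI)
  then have "\<exists>v. y = u + v \<and> v \<in> (\<lambda>g. t *\<^sub>R g) ` A u" by (intro exI[of _ "y - u"]) simp
  then show "u \<in> resolvent (operator_scale t A) y"
    unfolding resolvent_def operator_inverse_def operator_sum_def
        single_valued_operator_def operator_scale_def by auto
qed

lemma mem_solution_set_iff: "x \<in> solution_set F G \<longleftrightarrow> - F x \<in> G x"
proof -
  have "0 = F x + v \<longleftrightarrow> v = - F x" for v
    by (auto simp: eq_neg_iff_add_eq_0 add.commute)
  then show ?thesis
    by (simp add: solution_set_def operator_inverse_def operator_sum_def single_valued_operator_def)
qed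

lemma monotone_operatorD:
  assumes "monotone_operator A" "u \<in> A x" "v \<in> A y"
  shows "0 \<le> inner (u - v) (x - y)"
  using assms by (auto simp: monotone_operator_def)

text \<open>Maximality in usable form: a pair that is monotonically related to the whole graph can be
  added to the graph without destroying monotonicity, so it already belongs to it.\<close>

lemma maximally_monotone_memI:
  assumes A: "maximally_monotone A"
    and u: "\<And>y v. v \<in> A y \<Longrightarrow> 0 \<le> inner (u - v) (x - y)"
  shows "u \<in> A x"
proof -
  have mono: "monotone_operator A" using A by (simp add: maximally_monotone_def)
  define B where "B = A(x := insert u (A x))"
  have sym: "0 \<le> inner (v - u) (y - x)" if "v \<in> A y" for y v
    using u[OF that] by (simp add: inner_diff_left inner_diff_right)
  have "monotone_operator B"
    unfolding monotone_operator_def B_def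
    using u sym monotone_operatorD[OF mono] by (auto split: if_splits)
  moreover have "\<forall>y. A y \<subseteq> B y" by (auto simp: B_def)
  ultimately have "B = A" using A by (simp add: maximally_monotone_def)
  then show ?thesis by (metis B_def fun_upd_same insertI1)
qed

lemma maximally_monotone_closed_graph:
  assumes A: "maximally_monotone A"
    and x: "xs \<longlonglongrightarrow> x" and u: "us \<longlonglongrightarrow> u"
    and mem: "\<And>n. us n \<in> A (xs n)"
  shows "u \<in> A x"
proof (rule maximally_monotone_memI[OF A])
  fix y v assume v: "v \<in> A y"
  have "(\<lambda>n. inner (us n - v) (xs n - y)) \<longlonglongrightarrow> inner (u - v) (x - y)"
    by (intro tendsto_intros x u)
  moreover have "0 \<le> inner (us n - v) (xs n - y)" for n
    using A mem v by (auto simp: maximally_monotone_def monotone_operator_def)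
  ultimately show "0 \<le> inner (u - v) (x - y)"
    by (intro LIMSEQ_le_const) auto
qed

lemma resolvent_scale_nonexpansive:
  assumes A: "monotone_operator A" and t: "0 < t"
    and u: "u \<in> resolvent (operator_scale t A) x"
    and v: "v \<in> resolvent (operator_scale t A) y"
  shows "norm (u - v) \<le> norm (x - y)"
proof -
  have "0 \<le> t * inner ((1 / t) *\<^sub>R (x - u) - (1 / t) *\<^sub>R (y - v)) (u - v)"
    using u v t by (intro mult_nonneg_nonneg monotone_operatorD[OF A])
      (auto simp: mem_resolvent_scale_iff)
  also have "\<dots> = inner (x - y) (u - v) - (norm (u - v))\<^sup>2"
    using t by (simp add: power2_norm_eq_inner inner_diff_left inner_diff_right algebra_simps)
  also have "inner (x - y) (u - v) \<le> norm (x - y) * norm (u - v)"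
    by (rule norm_cauchy_schwarz)
  finally have "norm (u - v) * norm (u - v) \<le> norm (x - y) * norm (u - v)"
    by (simp add: power2_eq_square)
  then show ?thesis
    by (cases "norm (u - v) = 0") (auto simp: mult_le_cancel_right)
qed

text \<open>The resolvent is nonexpansive where it is defined, and its domain is closed: along a convergent
  sequence of arguments the values form a Cauchy sequence, and the closed graph puts their limit
  into the resolvent at the limit argument. A function that is continuous on a closed set and
  zero elsewhere is Borel. This is what makes the half steps random variables.\<close>

lemma resolvent_scale_measurable_selection:
  fixes A :: "'a::euclidean_space \<Rightarrow> 'a set"
  assumes A: "maximally_monotone A" and t: "0 < t"
  obtains J :: "'a \<Rightarrow> 'a" where "J \<in> borel_measurable borel"
    and "\<And>u y. u \<in> resolvent (operator_scale t A) y \<Longrightarrow> u = J y"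
proof -
  let ?R = "resolvent (operator_scale t A)"
  have mono: "monotone_operator A" using A by (simp add: maximally_monotone_def)
  define D where "D = {y. ?R y \<noteq> {}}"
  define f where "f y = (SOME u. u \<in> ?R y)" for y
  have f: "f y \<in> ?R y" if "y \<in> D" for y
    using that unfolding D_def f_def by (auto intro: someI)
  have lip: "norm (f x - f y) \<le> norm (x - y)" if "x \<in> D" "y \<in> D" for x y
    using resolvent_scale_nonexpansive[OF mono t f f] that by auto
  have cont: "continuous_on D f"
    unfolding continuous_on_iff dist_norm using lip by (meson le_less_trans)
  have "closed D"
    unfolding closed_sequential_limits
  proof (intro allI impI, elim conjE)
    fix ys y assume ys: "\<forall>n. ys n \<in> D" and lim: "ys \<longlonglongrightarrow> y"
    have "Cauchy (\<lambda>n. f (ys n))"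
    proof (rule metric_CauchyI)
      fix e :: real assume "0 < e"
      then obtain N where "\<forall>m\<ge>N. \<forall>n\<ge>N. dist (ys m) (ys n) < e"
        using LIMSEQ_imp_Cauchy[OF lim] by (auto simp: Cauchy_def)
      then show "\<exists>N. \<forall>m\<ge>N. \<forall>n\<ge>N. dist (f (ys m)) (f (ys n)) < e"
        using lip ys unfolding dist_norm by (meson le_less_trans)
    qed
    then obtain u where u: "(\<lambda>n. f (ys n)) \<longlonglongrightarrow> u"
      using Cauchy_convergent convergent_def by blast
    have "(1 / t) *\<^sub>R (y - u) \<in> A u"
    proof (rule maximally_monotone_closed_graph[OF A u])
      show "(\<lambda>n. (1 / t) *\<^sub>R (ys n - f (ys n))) \<longlonglongrightarrow> (1 / t) *\<^sub>R (y - u)"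
        by (intro tendsto_intros lim u)
      show "(1 / t) *\<^sub>R (ys n - f (ys n)) \<in> A (f (ys n))" for n
        using f[of "ys n"] ys t by (simp add: mem_resolvent_scale_iff)
    qed
    then have "u \<in> ?R y" using t by (simp add: mem_resolvent_scale_iff)
    then show "y \<in> D" by (auto simp: D_def)
  qed
  then have "(\<lambda>y. indicator D y *\<^sub>R f y) \<in> borel_measurable borel"
    by (intro borel_measurable_continuous_on_indicator cont) auto
  moreover have "u = indicator D y *\<^sub>R f y" if u: "u \<in> ?R y" for u y
  proof -
    have y: "y \<in> D" using u by (auto simp: D_def)
    then show ?thesis
      using resolvent_scale_nonexpansive[OF mono t u f[OF y]] by simp
  qed
  ultimately show ?thesis by (rule that)
qed

section \<open>One step with a stochastic forward map\<close>

locale lipschitz_oracle = prob_space Q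
  for Q :: "'s measure" +
  fixes F\<xi> :: "'s \<Rightarrow> 'a::euclidean_space \<Rightarrow> 'a" and F :: "'a \<Rightarrow> 'a" and L :: real
  assumes mean_oracle: "lipschitz_in_mean_oracle Q F\<xi> F L" and L_pos: "0 < L"
begin

lemma oracle_measurable [measurable]: "case_prod F\<xi> \<in> borel_measurable (Q \<Otimes>\<^sub>M borel)"
  using mean_oracle by (simp add: lipschitz_in_mean_oracle_def)

lemma oracle_integrable: "integrable Q (\<lambda>s. F\<xi> s u)"
  and oracle_unbiased: "(\<integral>s. F\<xi> s u \<partial>Q) = F u"
  using mean_oracle by (simp_all add: lipschitz_in_mean_oracle_def)

lemma oracle_section_measurable [measurable]: "(\<lambda>s. F\<xi> s u) \<in> borel_measurable Q"
  using oracle_integrable by (rule borel_measurable_integrable)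

lemma oracle_diff_square_integrable: "integrable Q (\<lambda>s. (norm (F\<xi> s u - F\<xi> s v))\<^sup>2)"
  and oracle_diff_second_moment: "(\<integral>s. (norm (F\<xi> s u - F\<xi> s v))\<^sup>2 \<partial>Q) \<le> L\<^sup>2 * (norm (u - v))\<^sup>2"
proof -
  have le: "(\<integral>\<^sup>+ s. ennreal ((norm (F\<xi> s u - F\<xi> s v))\<^sup>2) \<partial>Q) \<le> ennreal (L\<^sup>2 * (norm (u - v))\<^sup>2)"
    using mean_oracle by (simp add: lipschitz_in_mean_oracle_def)
  show int: "integrable Q (\<lambda>s. (norm (F\<xi> s u - F\<xi> s v))\<^sup>2)"
    using le by (intro integrableI_bounded) (auto intro: le_less_trans)
  show "(\<integral>s. (norm (F\<xi> s u - F\<xi> s v))\<^sup>2 \<partial>Q) \<le> L\<^sup>2 * (norm (u - v))\<^sup>2"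
    using le nn_integral_eq_integral[OF int] by (simp add: ennreal_le_iff)
qed

lemma mean_lipschitz: "norm (F u - F v) \<le> L * norm (u - v)"
proof -
  let ?g = "\<lambda>s. norm (F\<xi> s u - F\<xi> s v)"
  have g: "integrable Q ?g" by (intro integrable_norm Bochner_Integration.integrable_diff oracle_integrable)
  have "F u - F v = (\<integral>s. F\<xi> s u - F\<xi> s v \<partial>Q)"
    by (simp add: oracle_integrable oracle_unbiased)
  then have "norm (F u - F v) \<le> (\<integral>s. ?g s \<partial>Q)" by simp
  then have "(norm (F u - F v))\<^sup>2 \<le> (\<integral>s. ?g s \<partial>Q)\<^sup>2" by (intro power_mono) auto
  also have "\<dots> \<le> (\<integral>s. (?g s)\<^sup>2 \<partial>Q)"
    using variance_positive[of ?g] variance_eq[OF g oracle_diff_square_integrable] by simp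
  also have "\<dots> \<le> (L * norm (u - v))\<^sup>2"
    using oracle_diff_second_moment by (simp add: power_mult_distrib)
  finally show ?thesis by (rule power2_le_imp_le) (use L_pos in simp)
qed

lemma mean_continuous: "continuous_on UNIV F"
proof (rule lipschitz_on_continuous_on)
  show "L-lipschitz_on UNIV F"
    using mean_lipschitz L_pos by (intro lipschitz_onI) (auto simp: dist_norm)
qed

text \<open>The correction has mean $t\,(F(h) - F(w))$, and the mean Lipschitz bound controls its second
  moment; expanding the square gives the estimate.\<close>

lemma corrected_step_integrable:
    "integrable Q (\<lambda>s. (norm (h - t *\<^sub>R (F\<xi> s h - F\<xi> s w) - x))\<^sup>2)" (is ?int)
  and corrected_step_second_moment:
    "(\<integral>s. (norm (h - t *\<^sub>R (F\<xi> s h - F\<xi> s w) - x))\<^sup>2 \<partial>Q)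
       \<le> (norm (h - x))\<^sup>2 - 2 * t * inner (F h - F w) (h - x) + t\<^sup>2 * L\<^sup>2 * (norm (h - w))\<^sup>2" (is ?le)
proof -
  let ?D = "\<lambda>s. F\<xi> s h - F\<xi> s w"
  have expand: "(norm (h - t *\<^sub>R ?D s - x))\<^sup>2
      = (norm (h - x))\<^sup>2 - 2 * t * inner (?D s) (h - x) + t\<^sup>2 * (norm (?D s))\<^sup>2" for s
    unfolding power2_norm_eq_inner
    by (simp add: inner_diff_left inner_diff_right inner_commute power2_eq_square algebra_simps)
  have D: "integrable Q ?D" by (intro Bochner_Integration.integrable_diff oracle_integrable)
  have i1: "integrable Q (\<lambda>s. 2 * t * inner (?D s) (h - x))"
    by (intro integrable_mult_right integrable_inner_left D)
  have i2: "integrable Q (\<lambda>s. t\<^sup>2 * (norm (?D s))\<^sup>2)"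
    by (intro integrable_mult_right oracle_diff_square_integrable)
  show ?int unfolding expand using i1 i2 by simp
  have "(\<integral>s. ?D s \<partial>Q) = F h - F w"
    by (simp add: oracle_integrable oracle_unbiased)
  then have "(\<integral>s. inner (?D s) (h - x) \<partial>Q) = inner (F h - F w) (h - x)"
    using D by (simp add: integral_inner_left)
  then have "(\<integral>s. (norm (h - t *\<^sub>R ?D s - x))\<^sup>2 \<partial>Q)
      = (norm (h - x))\<^sup>2 - 2 * t * inner (F h - F w) (h - x) + t\<^sup>2 * (\<integral>s. (norm (?D s))\<^sup>2 \<partial>Q)"
    unfolding expand using i1 i2 by (simp add: prob_space)
  moreover have "t\<^sup>2 * (\<integral>s. (norm (?D s))\<^sup>2 \<partial>Q) \<le> t\<^sup>2 * (L\<^sup>2 * (norm (h - w))\<^sup>2)"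
    by (intro mult_left_mono oracle_diff_second_moment) simp
  ultimately show ?le by (simp only: mult.assoc)
qed

text \<open>The resolvent inclusion tested against \<open>- F x \<in> G x\<close>, together with monotonicity of \<open>F\<close>
  between \<open>h\<close> and \<open>x\<close>, bounds the cross term of the corrected step by
  $\langle m - h, h - x\rangle$, where $m = \alpha a + (1-\alpha) b$. The three-point identity
  splits this into squared distances. What remains is $-\alpha\|a-h\|^2$ and the term in
  $\|b-h\|^2$, whose weight $1-\alpha$ has to pay for the second moment $t^2L^2$ of the
  correction.\<close>

lemma corrected_step_descent:
  assumes F: "monotone_operator (single_valued_operator F)" and G: "monotone_operator G"
    and x: "x \<in> solution_set F G" and t: "0 < t"
    and h: "h \<in> resolvent (operator_scale t G) (\<alpha> *\<^sub>R a + (1 - \<alpha>) *\<^sub>R b - t *\<^sub>R F b)"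
  shows "(\<integral>s. (norm (h - t *\<^sub>R (F\<xi> s h - F\<xi> s b) - x))\<^sup>2 \<partial>Q)
    \<le> \<alpha> * (norm (a - x))\<^sup>2 + (1 - \<alpha>) * (norm (b - x))\<^sup>2
      - (\<alpha> * (norm (a - h))\<^sup>2 + (1 - \<alpha> - t\<^sup>2 * L\<^sup>2) * (norm (b - h))\<^sup>2)"
proof -
  define m where "m = \<alpha> *\<^sub>R a + (1 - \<alpha>) *\<^sub>R b"
  have "0 \<le> inner ((1 / t) *\<^sub>R (m - t *\<^sub>R F b - h) - (- F x)) (h - x)"
    using h x t unfolding m_def
    by (intro monotone_operatorD[OF G]) (auto simp: mem_resolvent_scale_iff mem_solution_set_iff)
  then have "0 \<le> t * inner ((1 / t) *\<^sub>R (m - t *\<^sub>R F b - h) - (- F x)) (h - x)"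
    using t by simp
  also have "\<dots> = inner (m - h) (h - x) - t * inner (F b - F x) (h - x)"
    using t by (simp add: inner_diff_left inner_add_left algebra_simps)
  finally have res: "t * inner (F b - F x) (h - x) \<le> inner (m - h) (h - x)" by simp
  have "0 \<le> t * inner (F h - F x) (h - x)"
    using t by (intro mult_nonneg_nonneg monotone_operatorD[OF F]) (auto simp: single_valued_operator_def)
  with res have "- t * inner (F h - F b) (h - x) \<le> inner (m - h) (h - x)"
    by (simp add: inner_diff_left algebra_simps)
  moreover have "(norm (h - x))\<^sup>2 + 2 * inner (m - h) (h - x)
      = \<alpha> * (norm (a - x))\<^sup>2 + (1 - \<alpha>) * (norm (b - x))\<^sup>2
        - \<alpha> * (norm (a - h))\<^sup>2 - (1 - \<alpha>) * (norm (b - h))\<^sup>2"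
    unfolding m_def power2_norm_eq_inner
    by (simp add: inner_diff_left inner_diff_right inner_add_left inner_commute algebra_simps)
  ultimately show ?thesis
    using corrected_step_second_moment[of h t b x]
    by (simp add: norm_minus_commute[of h b] algebra_simps)
qed

end

section \<open>Supermartingales, independence and measurable selection\<close>

text \<open>Integrating out an independent variable first, with the other one held fixed. The
  two variables may take values in different types, which is why independence is assumed as a
  product rule for probabilities. With \<open>X\<close> the identity into a sub-sigma-algebra this computes
  conditional expectations given the past.\<close>

lemma (in prob_space) nn_integral_freeze_independent:
  assumes X: "X \<in> M \<rightarrow>\<^sub>M N" and Y: "Y \<in> M \<rightarrow>\<^sub>M S"
    and indep: "\<And>A B. A \<in> sets N \<Longrightarrow> B \<in> sets S \<Longrightarrow>
      prob (X -` A \<inter> Y -` B \<inter> space M) = prob (X -` A \<inter> space M) * prob (Y -` B \<inter> space M)"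
    and f: "f \<in> borel_measurable (N \<Otimes>\<^sub>M S)"
  shows "(\<integral>\<^sup>+ \<omega>. f (X \<omega>, Y \<omega>) \<partial>M) = (\<integral>\<^sup>+ \<omega>. \<integral>\<^sup>+ y. f (X \<omega>, y) \<partial>distr M S Y \<partial>M)"
proof -
  interpret X: prob_space "distr M N X" by (rule prob_space_distr) fact
  interpret Y: prob_space "distr M S Y" by (rule prob_space_distr) fact
  have XY: "(\<lambda>\<omega>. (X \<omega>, Y \<omega>)) \<in> M \<rightarrow>\<^sub>M N \<Otimes>\<^sub>M S" using X Y by simp
  have joint: "distr M N X \<Otimes>\<^sub>M distr M S Y = distr M (N \<Otimes>\<^sub>M S) (\<lambda>\<omega>. (X \<omega>, Y \<omega>))"
  proof (rule pair_measure_eqI)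
    fix A B assume "A \<in> sets (distr M N X)" "B \<in> sets (distr M S Y)"
    then have A: "A \<in> sets N" and B: "B \<in> sets S" by simp_all
    have "(\<lambda>\<omega>. (X \<omega>, Y \<omega>)) -` (A \<times> B) \<inter> space M = X -` A \<inter> Y -` B \<inter> space M" by auto
    then show "emeasure (distr M N X) A * emeasure (distr M S Y) B
        = emeasure (distr M (N \<Otimes>\<^sub>M S) (\<lambda>\<omega>. (X \<omega>, Y \<omega>))) (A \<times> B)"
      using indep[OF A B] X Y XY A B
      by (simp add: emeasure_distr emeasure_eq_measure ennreal_mult[symmetric])
  qed (auto simp: X.sigma_finite_measure_axioms Y.sigma_finite_measure_axioms)
  have f': "f \<in> borel_measurable (distr M N X \<Otimes>\<^sub>M distr M S Y)"
    using f by simp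
  have "(\<integral>\<^sup>+ \<omega>. f (X \<omega>, Y \<omega>) \<partial>M) = (\<integral>\<^sup>+ q. f q \<partial>distr M (N \<Otimes>\<^sub>M S) (\<lambda>\<omega>. (X \<omega>, Y \<omega>)))"
    using XY f by (subst nn_integral_distr) auto
  also have "\<dots> = (\<integral>\<^sup>+ x. \<integral>\<^sup>+ y. f (x, y) \<partial>distr M S Y \<partial>distr M N X)"
    unfolding joint[symmetric] by (rule Y.nn_integral_fst[OF f', symmetric])
  also have "\<dots> = (\<integral>\<^sup>+ \<omega>. \<integral>\<^sup>+ y. f (X \<omega>, y) \<partial>distr M S Y \<partial>M)"
    using Y.borel_measurable_nn_integral_fst[OF f'] by (intro nn_integral_distr X) simp
  finally show ?thesis .
qed

text \<open>Ville's inequality. The process is stopped when it first reaches \<open>l\<close> and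
  is then replaced by the constant \<open>l\<close>; the means of the stopped process \<open>U\<close> do not increase, since
  on the event of no crossing so far the step inequality applies. Truncating the initial
  value at \<open>l\<close> on the right-hand side makes the bound go to zero by dominated convergence when
  the starting values tend to zero almost surely.\<close>

lemma nonneg_supermartingale_maximal_inequality:
  fixes V :: "nat \<Rightarrow> 'w \<Rightarrow> ennreal" and l :: ennreal
  assumes sub: "\<And>k. subalgebra M (N k)"
    and mono: "\<And>k. sets (N k) \<subseteq> sets (N (Suc k))"
    and adapted: "\<And>k. V k \<in> borel_measurable (N k)"
    and step: "\<And>k A. A \<in> sets (N k) \<Longrightarrow>
      (\<integral>\<^sup>+ \<omega>. V (Suc k) \<omega> * indicator A \<omega> \<partial>M) \<le> (\<integral>\<^sup>+ \<omega>. V k \<omega> * indicator A \<omega> \<partial>M)"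
  shows "l * emeasure M {\<omega> \<in> space M. \<exists>k. l \<le> V k \<omega>} \<le> (\<integral>\<^sup>+ \<omega>. min (V 0 \<omega>) l \<partial>M)"
proof -
  have spN: "space (N k) = space M" and subM: "sets (N k) \<subseteq> sets M" for k
    using sub[of k] by (auto simp: subalgebra_def)
  have le: "sets (N j) \<subseteq> sets (N k)" if "j \<le> k" for j k
    using lift_Suc_mono_le[of "\<lambda>k. sets (N k)", OF mono that] .
  have VM [measurable]: "V k \<in> borel_measurable M" for k
    using adapted sub by (rule measurable_from_subalg[rotated])
  define B where "B k = {\<omega> \<in> space M. \<forall>j\<le>k. V j \<omega> < l}" for k
  have VN: "V j \<in> borel_measurable (N k)" if "j \<le> k" for j k
    by (rule measurable_from_subalg[OF _ adapted]) (simp add: subalgebra_def spN le[OF that])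
  have BN: "B k \<in> sets (N k)" for k
  proof -
    have "B k = (\<Inter>j\<in>{..k}. {\<omega> \<in> space (N k). V j \<omega> < l})"
      by (auto simp: B_def spN)
    also have "\<dots> \<in> sets (N k)"
      by (intro sets.finite_INT borel_measurable_less VN) auto
    finally show ?thesis .
  qed
  have BM [measurable]: "B k \<in> sets M" for k using BN subM by auto
  define U where "U k \<omega> = V k \<omega> * indicator (B k) \<omega> + l * indicator (space M - B k) \<omega>" for k \<omega>
  have U_step: "(\<integral>\<^sup>+ \<omega>. U (Suc k) \<omega> \<partial>M) \<le> (\<integral>\<^sup>+ \<omega>. U k \<omega> \<partial>M)" for k
  proof -
    have "(\<integral>\<^sup>+ \<omega>. U (Suc k) \<omega> \<partial>M)
        \<le> (\<integral>\<^sup>+ \<omega>. V (Suc k) \<omega> * indicator (B k) \<omega> + l * indicator (space M - B k) \<omega> \<partial>M)"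
      by (intro nn_integral_mono) (auto simp: U_def B_def le_Suc_eq split: split_indicator)
    also have "\<dots> = (\<integral>\<^sup>+ \<omega>. V (Suc k) \<omega> * indicator (B k) \<omega> \<partial>M)
        + (\<integral>\<^sup>+ \<omega>. l * indicator (space M - B k) \<omega> \<partial>M)"
      by (intro nn_integral_add) auto
    also have "\<dots> \<le> (\<integral>\<^sup>+ \<omega>. V k \<omega> * indicator (B k) \<omega> \<partial>M)
        + (\<integral>\<^sup>+ \<omega>. l * indicator (space M - B k) \<omega> \<partial>M)"
      by (intro add_right_mono step BN)
    also have "\<dots> = (\<integral>\<^sup>+ \<omega>. U k \<omega> \<partial>M)"
      unfolding U_def by (intro nn_integral_add[symmetric]) auto
    finally show ?thesis .
  qed
  have U_0: "(\<integral>\<^sup>+ \<omega>. U 0 \<omega> \<partial>M) = (\<integral>\<^sup>+ \<omega>. min (V 0 \<omega>) l \<partial>M)"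
    by (intro nn_integral_cong) (auto simp: U_def B_def min_def split: split_indicator)
  have U_le: "(\<integral>\<^sup>+ \<omega>. U k \<omega> \<partial>M) \<le> (\<integral>\<^sup>+ \<omega>. min (V 0 \<omega>) l \<partial>M)" for k
    by (induction k) (use U_0 U_step order_trans in auto)
  have exc: "l * emeasure M (space M - B k) \<le> (\<integral>\<^sup>+ \<omega>. min (V 0 \<omega>) l \<partial>M)" for k
  proof -
    have "l * emeasure M (space M - B k) = (\<integral>\<^sup>+ \<omega>. l * indicator (space M - B k) \<omega> \<partial>M)"
      by (intro nn_integral_cmult_indicator[symmetric]) auto
    also have "\<dots> \<le> (\<integral>\<^sup>+ \<omega>. U k \<omega> \<partial>M)"
      by (intro nn_integral_mono) (simp add: U_def)
    finally show ?thesis using U_le order_trans by blast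
  qed
  have "{\<omega> \<in> space M. \<exists>k. l \<le> V k \<omega>} = (\<Union>k. space M - B k)"
    by (auto simp: B_def not_less) (meson leD order_refl)
  moreover have "(SUP k. emeasure M (space M - B k)) = emeasure M (\<Union>k. space M - B k)"
    by (intro SUP_emeasure_incseq) (auto simp: incseq_def B_def)
  ultimately have "l * emeasure M {\<omega> \<in> space M. \<exists>k. l \<le> V k \<omega>}
      = (SUP k. l * emeasure M (space M - B k))"
    by (metis SUP_mult_left_ennreal)
  also have "\<dots> \<le> (\<integral>\<^sup>+ \<omega>. min (V 0 \<omega>) l \<partial>M)"
    by (intro SUP_least exc)
  finally show ?thesis .
qed

lemma AE_tendsto_0_if_summable_means:
  fixes X :: "nat \<Rightarrow> 'w \<Rightarrow> real"
  assumes [measurable]: "\<And>k. X k \<in> borel_measurable M"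
    and nonneg: "\<And>k \<omega>. 0 \<le> X k \<omega>"
    and bound: "\<And>n. (\<Sum>k<n. \<integral>\<^sup>+ \<omega>. X k \<omega> \<partial>M) \<le> C" and C: "C < \<infinity>"
  shows "AE \<omega> in M. (\<lambda>k. X k \<omega>) \<longlonglongrightarrow> 0"
proof -
  have "(\<integral>\<^sup>+ \<omega>. (\<Sum>k. ennreal (X k \<omega>)) \<partial>M) = (\<Sum>k. \<integral>\<^sup>+ \<omega>. X k \<omega> \<partial>M)"
    by (intro nn_integral_suminf) auto
  also have "\<dots> \<le> C" using bound by (intro suminf_le_const) auto
  finally have "(\<integral>\<^sup>+ \<omega>. (\<Sum>k. ennreal (X k \<omega>)) \<partial>M) \<noteq> \<infinity>" using C by auto
  then have "AE \<omega> in M. (\<Sum>k. ennreal (X k \<omega>)) \<noteq> \<infinity>"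
    by (intro nn_integral_PInf_AE) auto
  then show ?thesis
    by eventually_elim
      (auto intro!: summable_LIMSEQ_zero summable_suminf_not_top nonneg)
qed

text \<open>Test the hypothesis on the event where the conditional expectation exceeds \<open>g\<close>.\<close>

lemma (in sigma_finite_subalgebra) real_cond_exp_le:
  assumes f: "integrable M f" and g: "integrable M g" "g \<in> borel_measurable F"
    and le: "\<And>A. A \<in> sets F \<Longrightarrow> (\<integral>\<omega>\<in>A. f \<omega> \<partial>M) \<le> (\<integral>\<omega>\<in>A. g \<omega> \<partial>M)"
  shows "AE \<omega> in M. real_cond_exp M F f \<omega> \<le> g \<omega>"
proof -
  let ?e = "real_cond_exp M F f"
  define A where "A = {\<omega> \<in> space F. g \<omega> < ?e \<omega>}"
  have AF: "A \<in> sets F"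
    unfolding A_def using g(2) by measurable
  then have AM: "A \<in> sets M" using subalg by (auto simp: subalgebra_def)
  let ?d = "\<lambda>\<omega>. indicator A \<omega> * (?e \<omega> - g \<omega>)"
  have e: "integrable M ?e" using f by (rule real_cond_exp_int)
  have ie: "integrable M (\<lambda>\<omega>. indicator A \<omega> * ?e \<omega>)" and ig: "integrable M (\<lambda>\<omega>. indicator A \<omega> * g \<omega>)"
    using integrable_mult_indicator[OF AM e] integrable_mult_indicator[OF AM g(1)] by auto
  have d: "integrable M ?d" using ie ig by (simp add: right_diff_distrib)
  have nonneg: "0 \<le> ?d \<omega>" for \<omega> by (auto simp: A_def split: split_indicator)
  have "(\<integral>\<omega>. ?d \<omega> \<partial>M) = (\<integral>\<omega>\<in>A. ?e \<omega> \<partial>M) - (\<integral>\<omega>\<in>A. g \<omega> \<partial>M)"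
    using ie ig by (simp add: right_diff_distrib set_lebesgue_integral_def)
  also have "\<dots> \<le> 0" using le[OF AF] real_cond_exp_intA[OF f AF] by simp
  finally have "(\<integral>\<omega>. ?d \<omega> \<partial>M) = 0" using nonneg by (intro antisym Bochner_Integration.integral_nonneg)
  then have "AE \<omega> in M. ?d \<omega> = 0"
    using integral_nonneg_eq_0_iff_AE[OF d] nonneg by simp
  moreover have "space F = space M" using subalg by (simp add: subalgebra_def)
  ultimately show ?thesis
    by (elim AE_mp) (auto intro!: AE_I2 simp: A_def split: split_indicator)
qed

text \<open>A nearly closest point of \<open>S\<close> can be chosen in a Borel way: a countable dense subset contains
  good points for every \<open>y\<close>, and the index of the first one is a measurable function of \<open>y\<close>.\<close>

lemma measurable_near_projection:
  fixes S :: "'a::euclidean_space set"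
  assumes S: "S \<noteq> {}" and e: "0 < e"
  obtains P :: "'a \<Rightarrow> 'a" where "P \<in> borel_measurable borel" "\<And>y. P y \<in> S"
    "\<And>y. dist y (P y) < infdist y S + e"
proof -
  obtain T where T: "countable T" "T \<subseteq> S" "S \<subseteq> closure T"
    using separable by blast
  then have "T \<noteq> {}" using S by auto
  define q where "q = from_nat_into T"
  have q: "range q = T" using T \<open>T \<noteq> {}\<close> by (simp add: q_def)
  define i where "i y = (LEAST n. dist y (q n) < infdist y S + e)" for y
  have ex: "\<exists>n. dist y (q n) < infdist y S + e" for y
  proof -
    have "\<exists>a\<in>S. dist y a < infdist y S + e"
    proof -
      have "bdd_below ((\<lambda>a. dist y a) ` S)" by (auto intro: bdd_belowI[of _ 0])
      then show ?thesis
        using S e cINF_less_iff[of S "\<lambda>a. dist y a" "infdist y S + e"]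
        by (simp add: infdist_notempty)
    qed
    then obtain a where a: "a \<in> S" "dist y a < infdist y S + e" by auto
    then have "a \<in> closure T" "0 < infdist y S + e - dist y a" using T by auto
    then obtain t where "t \<in> T" "dist t a < infdist y S + e - dist y a"
      using closure_approachable by metis
    then have "dist y t < infdist y S + e"
      using dist_triangle[of y t a] by (simp add: dist_commute)
    then show ?thesis using \<open>t \<in> T\<close> q by (metis imageE)
  qed
  have [measurable]: "(\<lambda>y. infdist y S) \<in> borel_measurable borel"
    by (intro borel_measurable_continuous_onI continuous_intros)
  have [measurable]: "i \<in> borel \<rightarrow>\<^sub>M count_space UNIV"
    unfolding i_def by measurable
  show ?thesis
  proof (rule that[of "\<lambda>y. q (i y)"])
    show "(\<lambda>y. q (i y)) \<in> borel_measurable borel" by measurable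
    show "q (i y) \<in> S" for y using q T by auto
    show "dist y (q (i y)) < infdist y S + e" for y
      unfolding i_def by (rule LeastI_ex[OF ex])
  qed
qed

lemma infdist_tendsto_0_if_cluster_points_mem:
  fixes w :: "nat \<Rightarrow> 'a::euclidean_space"
  assumes bounded: "bounded (range w)"
    and cluster: "\<And>r y. strict_mono r \<Longrightarrow> (\<lambda>n. w (r n)) \<longlonglongrightarrow> y \<Longrightarrow> y \<in> S"
  shows "(\<lambda>n. infdist (w n) S) \<longlonglongrightarrow> 0"
proof (rule ccontr)
  assume "\<not> ?thesis"
  then obtain e where e: "0 < e" "\<forall>N. \<exists>n\<ge>N. e \<le> infdist (w n) S"
    unfolding lim_sequentially by (auto simp: dist_real_def not_less infdist_nonneg)
  then have "infinite {n. e \<le> infdist (w n) S}"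
    by (auto simp: infinite_nat_iff_unbounded_le)
  then obtain r :: "nat \<Rightarrow> nat" where r: "strict_mono r" "\<And>n. e \<le> infdist (w (r n)) S"
    using infinite_enumerate by blast
  have "bounded (range (w \<circ> r))" using bounded by (rule bounded_subset) auto
  then obtain y s where s: "strict_mono s" "((w \<circ> r) \<circ> s) \<longlonglongrightarrow> y"
    using bounded_imp_convergent_subsequence by blast
  have "y \<in> S"
    using cluster[OF strict_mono_o[OF r(1) s(1)]] s(2) by (simp add: o_def)
  have "(\<lambda>n. infdist (w (r (s n))) S) \<longlonglongrightarrow> infdist y S"
    using s(2) by (intro tendsto_infdist) (simp add: o_def)
  then have "e \<le> infdist y S"
    using r(2) by (intro LIMSEQ_le_const) auto
  then show False using \<open>y \<in> S\<close> e by simp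
qed

lemma tendsto_0_if_norm_square_tendsto_0:
  fixes f :: "nat \<Rightarrow> 'a::real_normed_vector"
  assumes "(\<lambda>n. (norm (f n))\<^sup>2) \<longlonglongrightarrow> 0"
  shows "f \<longlonglongrightarrow> 0"
proof (rule tendsto_norm_zero_cancel)
  show "(\<lambda>n. norm (f n)) \<longlonglongrightarrow> 0"
    using tendsto_real_sqrt[OF assms] by simp
qed

section \<open>The randomness available before each draw\<close>

locale fbf = prob_space M + Q: lipschitz_oracle Q F\<xi> F L
  for M :: "'w measure" and Q :: "'s measure"
    and F\<xi> :: "'s \<Rightarrow> 'a::euclidean_space \<Rightarrow> 'a" and F :: "'a \<Rightarrow> 'a" and L :: real +
  fixes G :: "'a \<Rightarrow> 'a set" and \<alpha> p \<tau> \<gamma> :: real and z0 :: 'a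
    and \<xi> :: "nat \<Rightarrow> 'w \<Rightarrow> 's" and c :: "nat \<Rightarrow> 'w \<Rightarrow> bool"
    and z zh w :: "nat \<Rightarrow> 'w \<Rightarrow> 'a"
  assumes G: "maximally_monotone G" and F: "maximally_monotone (single_valued_operator F)"
    and \<alpha>: "0 \<le> \<alpha>" "\<alpha> < 1" and p: "0 < p" "p \<le> 1" and \<gamma>: "0 < \<gamma>" "\<gamma> < 1"
    and \<tau>: "\<tau> = sqrt (1 - \<alpha>) / L * \<gamma>"
    and randomness: "fbf_randomness M Q p \<xi> c"
    and iterates: "fbf_iterates M F\<xi> F G \<alpha> \<tau> z0 \<xi> c z zh w"
begin

abbreviation draw_space :: "('s \<times> bool) measure" where
  "draw_space \<equiv> Q \<Otimes>\<^sub>M count_space UNIV"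

abbreviation draw :: "nat \<Rightarrow> 'w \<Rightarrow> 's \<times> bool" where
  "draw k \<omega> \<equiv> (\<xi> k \<omega>, c k \<omega>)"

lemma \<tau>_pos: "0 < \<tau>"
  using \<tau> \<alpha> \<gamma> Q.L_pos by simp

lemma \<tau>_L: "\<tau>\<^sup>2 * L\<^sup>2 = (1 - \<alpha>) * \<gamma>\<^sup>2"
  using \<tau> \<alpha> Q.L_pos by (simp add: power_mult_distrib power_divide)

lemma iterates_0: "\<omega> \<in> space M \<Longrightarrow> z 0 \<omega> = z0" "\<omega> \<in> space M \<Longrightarrow> w 0 \<omega> = z0"
  using iterates by (auto simp: fbf_iterates_def)

lemma zh_mem: "\<omega> \<in> space M \<Longrightarrow>
    zh k \<omega> \<in> resolvent (operator_scale \<tau> G) (\<alpha> *\<^sub>R z k \<omega> + (1 - \<alpha>) *\<^sub>R w k \<omega> - \<tau> *\<^sub>R F (w k \<omega>))"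
  and z_Suc: "\<omega> \<in> space M \<Longrightarrow>
    z (Suc k) \<omega> = zh k \<omega> - \<tau> *\<^sub>R (F\<xi> (\<xi> k \<omega>) (zh k \<omega>) - F\<xi> (\<xi> k \<omega>) (w k \<omega>))"
  and w_Suc: "\<omega> \<in> space M \<Longrightarrow> w (Suc k) \<omega> = (if c k \<omega> then z (Suc k) \<omega> else w k \<omega>)"
  using iterates by (auto simp: fbf_iterates_def Let_def)

lemma draw_indep: "indep_vars (\<lambda>_. draw_space) draw UNIV"
  and draw_law: "distr M draw_space (draw k) = Q \<Otimes>\<^sub>M measure_pmf (bernoulli_pmf p)"
  using randomness by (auto simp: fbf_randomness_def)

lemma draw_measurable [measurable]: "draw k \<in> M \<rightarrow>\<^sub>M draw_space"
  using draw_indep by (auto simp: indep_vars_def)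

text \<open>This sigma-algebra sees every coin, whereas the history in the theorem sees the
  coins only through the reference points \<open>w\<close>. Independence of the next draw is immediate for the
  finer sigma-algebra and passes to the coarser one.\<close>

definition past :: "nat \<Rightarrow> 'w measure" where
  "past k = vimage_algebra (space M) (\<lambda>\<omega>. \<lambda>i\<in>{..<k}. draw i \<omega>) (Pi\<^sub>M {..<k} (\<lambda>_. draw_space))"

lemma space_past [simp]: "space (past k) = space M"
  by (simp add: past_def)

lemma past_draws_measurable:
  "(\<lambda>\<omega>. \<lambda>i\<in>{..<k}. draw i \<omega>) \<in> M \<rightarrow>\<^sub>M Pi\<^sub>M {..<k} (\<lambda>_. draw_space)"
  by (intro measurable_restrict) auto

lemma sets_past: "sets (past k) =
  {(\<lambda>\<omega>. \<lambda>i\<in>{..<k}. draw i \<omega>) -` B \<inter> space M | B. B \<in> sets (Pi\<^sub>M {..<k} (\<lambda>_. draw_space))}"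
  unfolding past_def using past_draws_measurable[of k]
  by (intro sets_vimage_algebra2) (auto simp: measurable_def)

lemma subalgebra_past: "subalgebra M (past k)"
  unfolding subalgebra_def sets_past using past_draws_measurable[of k]
  by (auto intro: measurable_sets)

lemma draw_past_measurable: "i < k \<Longrightarrow> draw i \<in> past k \<rightarrow>\<^sub>M draw_space"
proof -
  assume i: "i < k"
  have "(\<lambda>\<omega>. \<lambda>i\<in>{..<k}. draw i \<omega>) \<in> past k \<rightarrow>\<^sub>M Pi\<^sub>M {..<k} (\<lambda>_. draw_space)"
    unfolding past_def using past_draws_measurable[of k]
    by (intro measurable_vimage_algebra1) (auto simp: measurable_def)
  moreover have "(\<lambda>f. f i) \<in> Pi\<^sub>M {..<k} (\<lambda>_. draw_space) \<rightarrow>\<^sub>M draw_space"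
    by (rule measurable_component_singleton) (simp add: i)
  ultimately have "(\<lambda>\<omega>. (\<lambda>i\<in>{..<k}. draw i \<omega>) i) \<in> past k \<rightarrow>\<^sub>M draw_space"
    by (rule measurable_compose)
  then show ?thesis using i by simp
qed

lemma past_mono: assumes "j \<le> k" shows "sets (past j) \<subseteq> sets (past k)"
proof -
  have "(\<lambda>\<omega>. \<lambda>i\<in>{..<j}. draw i \<omega>) \<in> past k \<rightarrow>\<^sub>M Pi\<^sub>M {..<j} (\<lambda>_. draw_space)"
    using assms by (intro measurable_restrict draw_past_measurable) auto
  then show ?thesis
    unfolding past_def[of j] by (intro sets_image_in_sets) auto
qed

lemma measurable_past_mono:
  assumes "j \<le> k" "f \<in> past j \<rightarrow>\<^sub>M N" shows "f \<in> past k \<rightarrow>\<^sub>M N"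
  using past_mono[OF assms(1)] assms(2)
  by (intro measurable_from_subalg[of "past k" "past j"]) (auto simp: subalgebra_def)

lemma measurable_past_M: "f \<in> past k \<rightarrow>\<^sub>M N \<Longrightarrow> f \<in> M \<rightarrow>\<^sub>M N"
  by (rule measurable_from_subalg[OF subalgebra_past])

lemma indep_past_draw:
  assumes A: "A \<in> sets (past k)" and B: "B \<in> sets draw_space"
  shows "prob (A \<inter> draw k -` B \<inter> space M) = prob (A \<inter> space M) * prob (draw k -` B \<inter> space M)"
proof -
  \<comment> \<open>The single draw is wrapped as a family over \<open>{k}\<close>: both sides of \<open>indep_var\<close> have the same type.\<close>
  let ?P = "\<lambda>\<omega>. \<lambda>i\<in>{..<k}. draw i \<omega>" and ?R = "\<lambda>\<omega>. \<lambda>i\<in>{k}. draw i \<omega>"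
  let ?C = "(\<lambda>f. f k) -` B \<inter> space (Pi\<^sub>M {k} (\<lambda>_. draw_space))"
  obtain D where D: "D \<in> sets (Pi\<^sub>M {..<k} (\<lambda>_. draw_space))" and AD: "A = ?P -` D \<inter> space M"
    using A by (auto simp: sets_past)
  have indep: "indep_var (Pi\<^sub>M {..<k} (\<lambda>_. draw_space)) ?P (Pi\<^sub>M {k} (\<lambda>_. draw_space)) ?R"
    by (intro indep_var_restrict[OF draw_indep]) auto
  have C: "?C \<in> sets (Pi\<^sub>M {k} (\<lambda>_. draw_space))"
    using B by (intro measurable_sets[OF measurable_component_singleton]) auto
  have "?R \<omega> \<in> space (Pi\<^sub>M {k} (\<lambda>_. draw_space))" if "\<omega> \<in> space M" for \<omega>
    using that measurable_space[OF draw_measurable] by (auto simp: space_PiM)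
  then have RC: "?R -` ?C \<inter> space M = draw k -` B \<inter> space M"
    by auto
  have "prob (A \<inter> draw k -` B \<inter> space M) = prob ((\<lambda>\<omega>. (?P \<omega>, ?R \<omega>)) -` (D \<times> ?C) \<inter> space M)"
  proof (rule arg_cong[where f = prob])
    have "(\<lambda>\<omega>. (?P \<omega>, ?R \<omega>)) -` (D \<times> ?C) \<inter> space M = (?P -` D \<inter> space M) \<inter> (?R -` ?C \<inter> space M)"
      by blast
    then show "A \<inter> draw k -` B \<inter> space M = (\<lambda>\<omega>. (?P \<omega>, ?R \<omega>)) -` (D \<times> ?C) \<inter> space M"
      unfolding RC AD by blast
  qed
  also have "\<dots> = prob (?P -` D \<inter> space M) * prob (?R -` ?C \<inter> space M)"
    by (rule indep_varD[OF indep D C])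
  also have "?P -` D \<inter> space M = A \<inter> space M" using AD by blast
  finally show ?thesis by (simp only: RC)
qed

lemma nn_integral_next_draw:
  assumes f: "f \<in> borel_measurable (past k \<Otimes>\<^sub>M draw_space)"
  shows "(\<integral>\<^sup>+ \<omega>. f (\<omega>, \<xi> k \<omega>, c k \<omega>) \<partial>M)
    = (\<integral>\<^sup>+ \<omega>. \<integral>\<^sup>+ s. f (\<omega>, s, True) * p + f (\<omega>, s, False) * (1 - p) \<partial>Q \<partial>M)"
proof -
  have "(\<integral>\<^sup>+ \<omega>. f (\<omega>, \<xi> k \<omega>, c k \<omega>) \<partial>M)
      = (\<integral>\<^sup>+ \<omega>. \<integral>\<^sup>+ y. f (\<omega>, y) \<partial>(Q \<Otimes>\<^sub>M measure_pmf (bernoulli_pmf p)) \<partial>M)"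
    unfolding draw_law[of k, symmetric]
  proof (rule nn_integral_freeze_independent[OF _ draw_measurable _ f])
    show "(\<lambda>\<omega>. \<omega>) \<in> M \<rightarrow>\<^sub>M past k" by (rule measurable_past_M[OF measurable_ident_sets[OF refl]])
    show "prob ((\<lambda>\<omega>. \<omega>) -` A \<inter> draw k -` B \<inter> space M)
        = prob ((\<lambda>\<omega>. \<omega>) -` A \<inter> space M) * prob (draw k -` B \<inter> space M)"
      if "A \<in> sets (past k)" "B \<in> sets draw_space" for A B
      using indep_past_draw[OF that] by (simp only: vimage_ident)
  qed
  also have "\<dots> = (\<integral>\<^sup>+ \<omega>. \<integral>\<^sup>+ s. f (\<omega>, s, True) * p + f (\<omega>, s, False) * (1 - p) \<partial>Q \<partial>M)"
  proof (intro nn_integral_cong)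
    fix \<omega> assume "\<omega> \<in> space M"
    then have "(\<lambda>y. f (\<omega>, y)) \<in> borel_measurable draw_space"
      using f by (intro measurable_Pair2[of f "past k"]) auto
    also have "borel_measurable draw_space = borel_measurable (Q \<Otimes>\<^sub>M measure_pmf (bernoulli_pmf p))"
      by (intro measurable_cong_sets sets_pair_measure_cong) auto
    finally have "(\<integral>\<^sup>+ y. f (\<omega>, y) \<partial>(Q \<Otimes>\<^sub>M measure_pmf (bernoulli_pmf p)))
        = (\<integral>\<^sup>+ s. \<integral>\<^sup>+ b. f (\<omega>, s, b) \<partial>measure_pmf (bernoulli_pmf p) \<partial>Q)"
      by (rule measure_pmf.nn_integral_fst[symmetric])
    also have "\<dots> = (\<integral>\<^sup>+ s. f (\<omega>, s, True) * p + f (\<omega>, s, False) * (1 - p) \<partial>Q)"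
      using p by simp
    finally show "(\<integral>\<^sup>+ y. f (\<omega>, y) \<partial>(Q \<Otimes>\<^sub>M measure_pmf (bernoulli_pmf p)))
        = (\<integral>\<^sup>+ s. f (\<omega>, s, True) * p + f (\<omega>, s, False) * (1 - p) \<partial>Q)" .
  qed
  finally show ?thesis .
qed

section \<open>Adaptedness of the iterates\<close>

lemma mean_measurable [measurable]: "F \<in> borel_measurable borel"
  by (intro borel_measurable_continuous_onI Q.mean_continuous)

lemma zh_measurable:
  assumes N: "space N = space M"
    and [measurable]: "z k \<in> borel_measurable N" "w k \<in> borel_measurable N"
  shows "zh k \<in> borel_measurable N"
proof -
  obtain J where [measurable]: "J \<in> borel_measurable borel"
    and J: "\<And>u y. u \<in> resolvent (operator_scale \<tau> G) y \<Longrightarrow> u = J y"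
    using resolvent_scale_measurable_selection[OF G \<tau>_pos] by blast
  have "(\<lambda>\<omega>. J (\<alpha> *\<^sub>R z k \<omega> + (1 - \<alpha>) *\<^sub>R w k \<omega> - \<tau> *\<^sub>R F (w k \<omega>))) \<in> borel_measurable N"
    by measurable
  then show ?thesis
    by (subst measurable_cong[OF J[OF zh_mem]]) (simp add: N)
qed

text \<open>Stated, like the lemma on half steps above, for an arbitrary sigma-algebra, so that
  adaptedness follows both for the full past and for the coarser history.\<close>

lemma z_Suc_measurable:
  assumes N: "space N = space M"
    and [measurable]: "zh k \<in> borel_measurable N" "w k \<in> borel_measurable N" "\<xi> k \<in> N \<rightarrow>\<^sub>M Q"
  shows "z (Suc k) \<in> borel_measurable N"
proof -
  have "(\<lambda>\<omega>. zh k \<omega> - \<tau> *\<^sub>R (F\<xi> (\<xi> k \<omega>) (zh k \<omega>) - F\<xi> (\<xi> k \<omega>) (w k \<omega>))) \<in> borel_measurable N"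
    by measurable
  then show ?thesis by (subst measurable_cong[OF z_Suc]) (simp add: N)
qed

lemma iterates_past_measurable: "z k \<in> borel_measurable (past k) \<and> w k \<in> borel_measurable (past k)"
proof (induction k)
  case 0
  have "(\<lambda>_. z0) \<in> borel_measurable (past 0)" by simp
  then show ?case
    using measurable_cong[of "past 0" "z 0" "\<lambda>_. z0" borel]
      measurable_cong[of "past 0" "w 0" "\<lambda>_. z0" borel] iterates_0 by simp
next
  case (Suc k)
  have zw [measurable]: "z k \<in> borel_measurable (past (Suc k))" "w k \<in> borel_measurable (past (Suc k))"
    using Suc by (auto intro: measurable_past_mono[of k])
  have draw [measurable]: "draw k \<in> past (Suc k) \<rightarrow>\<^sub>M draw_space"
    by (rule draw_past_measurable) simp
  have [measurable]: "\<xi> k \<in> past (Suc k) \<rightarrow>\<^sub>M Q"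
    using measurable_compose[OF draw measurable_fst] by simp
  have [measurable]: "c k \<in> past (Suc k) \<rightarrow>\<^sub>M count_space UNIV"
    using measurable_compose[OF draw measurable_snd] by simp
  have [measurable]: "z (Suc k) \<in> borel_measurable (past (Suc k))"
    by (intro z_Suc_measurable zh_measurable) auto
  have "(\<lambda>\<omega>. if c k \<omega> then z (Suc k) \<omega> else w k \<omega>) \<in> borel_measurable (past (Suc k))"
    by measurable
  then have "w (Suc k) \<in> borel_measurable (past (Suc k))"
    by (subst measurable_cong[OF w_Suc]) auto
  then show ?case by simp
qed

lemma z_past [measurable]: "z k \<in> borel_measurable (past k)"
  and w_past [measurable]: "w k \<in> borel_measurable (past k)"
  and zh_past [measurable]: "zh k \<in> borel_measurable (past k)"
  using iterates_past_measurable zh_measurable[of "past k" k] by auto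

lemma z_M [measurable]: "z k \<in> borel_measurable M"
  and w_M [measurable]: "w k \<in> borel_measurable M"
  and zh_M [measurable]: "zh k \<in> borel_measurable M"
  by (rule measurable_past_M[OF z_past] measurable_past_M[OF w_past] measurable_past_M[OF zh_past])+

abbreviation history :: "nat \<Rightarrow> 'w measure" where
  "history k \<equiv> fbf_history M Q \<xi> w k"

lemma space_history [simp]: "space (history k) = space M"
  by (simp add: fbf_history_def space_measure_of_conv)

lemma sets_history: "sets (history k) = sigma_sets (space M)
     ({\<xi> i -` A \<inter> space M | i A. i < k \<and> A \<in> sets Q} \<union>
      {w i -` B \<inter> space M | i B. i \<le> k \<and> B \<in> sets borel})"
  unfolding fbf_history_def by (intro sets_measure_of) auto

lemma sets_history_subset_past: "sets (history k) \<subseteq> sets (past k)"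
proof -
  have "\<xi> i -` A \<inter> space M \<in> sets (past k)" if "i < k" "A \<in> sets Q" for i A
    using measurable_sets[OF measurable_compose[OF draw_past_measurable[OF that(1)] measurable_fst] that(2)]
    by simp
  moreover have "w i -` B \<inter> space M \<in> sets (past k)" if "i \<le> k" "B \<in> sets borel" for i B
    using measurable_sets[OF measurable_past_mono[OF that(1) w_past] that(2)] by simp
  ultimately have "sigma_sets (space (past k)) ({\<xi> i -` A \<inter> space M | i A. i < k \<and> A \<in> sets Q} \<union>
      {w i -` B \<inter> space M | i B. i \<le> k \<and> B \<in> sets borel}) \<subseteq> sets (past k)"
    by (intro sets.sigma_sets_subset) blast
  then show ?thesis by (simp add: sets_history)
qed

lemma subalgebra_history: "subalgebra M (history k)"
  using sets_history_subset_past[of k] subalgebra_past[of k] by (auto simp: subalgebra_def)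

lemma \<xi>_M: "\<xi> k \<in> M \<rightarrow>\<^sub>M Q"
  using measurable_compose[OF draw_measurable measurable_fst] by simp

lemma \<xi>_history: assumes "i < k" shows "\<xi> i \<in> history k \<rightarrow>\<^sub>M Q"
proof (rule measurableI)
  show "\<xi> i \<omega> \<in> space Q" if "\<omega> \<in> space (history k)" for \<omega>
    by (rule measurable_space[OF \<xi>_M]) (use that in simp)
  show "\<xi> i -` A \<inter> space (history k) \<in> sets (history k)" if "A \<in> sets Q" for A
    using assms that unfolding sets_history space_history by blast
qed

lemma w_history: assumes "i \<le> k" shows "w i \<in> borel_measurable (history k)"
proof (rule measurableI)
  show "w i -` A \<inter> space (history k) \<in> sets (history k)" if "A \<in> sets borel" for A
    using assms that unfolding sets_history space_history by blast
qed auto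

text \<open>The history does not list the points \<open>z\<close>, but it determines them: each one is
  computed from the initial point, the earlier samples and the earlier reference points.\<close>

lemma z_history: "i \<le> k \<Longrightarrow> z i \<in> borel_measurable (history k)"
proof (induction i)
  case 0
  have "(\<lambda>_. z0) \<in> borel_measurable (history k)" by simp
  then show ?case
    using measurable_cong[of "history k" "z 0" "\<lambda>_. z0" borel] iterates_0 by simp
next
  case (Suc i)
  then show ?case
    by (intro z_Suc_measurable zh_measurable w_history \<xi>_history) auto
qed

section \<open>Expected decrease\<close>

abbreviation \<Phi> :: "nat \<Rightarrow> 'a \<Rightarrow> 'w \<Rightarrow> real" where
  "\<Phi> \<equiv> lyapunov \<alpha> p z w"

text \<open>The surplus in the Lyapunov inequality. It is what forces the iterates together in the limit.\<close>

definition decrease :: "nat \<Rightarrow> 'w \<Rightarrow> real" where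
  "decrease k \<omega> = \<alpha> * (norm (z k \<omega> - zh k \<omega>))\<^sup>2 + (1 - \<alpha>) * (1 - \<gamma>\<^sup>2) * (norm (w k \<omega> - zh k \<omega>))\<^sup>2"

definition forward_step :: "nat \<Rightarrow> 'w \<Rightarrow> 's \<Rightarrow> 'a" where
  "forward_step k \<omega> s = zh k \<omega> - \<tau> *\<^sub>R (F\<xi> s (zh k \<omega>) - F\<xi> s (w k \<omega>))"

lemma gap_pos: "0 < 1 - \<gamma>\<^sup>2"
  using \<gamma> by (simp add: power_less_one_iff abs_square_less_1)

lemma \<Phi>_nonneg: "0 \<le> \<Phi> k x \<omega>"
  using \<alpha> p by (simp add: lyapunov_def)

lemma decrease_nonneg: "0 \<le> decrease k \<omega>"
  using \<alpha> gap_pos by (simp add: decrease_def)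

lemma decrease_M [measurable]: "decrease k \<in> borel_measurable M"
  unfolding decrease_def by measurable

lemma \<Phi>_past_measurable:
  assumes [measurable]: "X \<in> borel_measurable (past k)"
  shows "(\<lambda>\<omega>. \<Phi> k (X \<omega>) \<omega>) \<in> borel_measurable (past k)"
  unfolding lyapunov_def by measurable

lemma \<Phi>_M [measurable]:
  assumes [measurable]: "X \<in> borel_measurable M"
  shows "(\<lambda>\<omega>. \<Phi> k (X \<omega>) \<omega>) \<in> borel_measurable M"
  unfolding lyapunov_def by measurable

lemma forward_step_measurable:
  "(\<lambda>q. forward_step k (fst q) (fst (snd q))) \<in> borel_measurable (past k \<Otimes>\<^sub>M draw_space)"
  unfolding forward_step_def by measurable

text \<open>The step size is chosen such that $\tau^2L^2 = (1-\alpha)\gamma^2$, which leaves the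
  fraction $1-\gamma^2$ of the weight of $\|w_k - z_{k+1/2}\|^2$.\<close>

lemma forward_step_second_moment:
  assumes x: "x \<in> solution_set F G" and \<omega>: "\<omega> \<in> space M"
  shows "(\<integral>s. (norm (forward_step k \<omega> s - x))\<^sup>2 \<partial>Q)
    \<le> \<alpha> * (norm (z k \<omega> - x))\<^sup>2 + (1 - \<alpha>) * (norm (w k \<omega> - x))\<^sup>2 - decrease k \<omega>"
proof -
  have "monotone_operator (single_valued_operator F)" "monotone_operator G"
    using F G by (simp_all add: maximally_monotone_def)
  note descent = Q.corrected_step_descent[OF this x \<tau>_pos zh_mem[OF \<omega>]]
  have "1 - \<alpha> - \<tau>\<^sup>2 * L\<^sup>2 = (1 - \<alpha>) * (1 - \<gamma>\<^sup>2)"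
    unfolding \<tau>_L by (simp add: algebra_simps)
  with descent[of k] show ?thesis
    by (simp only: forward_step_def decrease_def)
qed

text \<open>Averaging over the coin gives $\|z_{k+1}-x\|^2$ the total weight
  $p(\alpha + \frac{1-\alpha}{p}) + (1-p)\alpha = 1$, and the old reference point keeps the weight
  $(1-p)\frac{1-\alpha}{p}$, which the second-moment bound completes to $\frac{1-\alpha}{p}$.\<close>

lemma next_draw_descent:
  fixes k x \<omega>
  assumes x: "x \<in> solution_set F G" and \<omega>: "\<omega> \<in> space M"
  defines "\<Psi> \<equiv> \<lambda>s y. ennreal (\<alpha> * (norm (forward_step k \<omega> s - x))\<^sup>2 + (1 - \<alpha>) / p * (norm (y - x))\<^sup>2)"
  shows "(\<integral>\<^sup>+ s. \<Psi> s (forward_step k \<omega> s) * p + \<Psi> s (w k \<omega>) * (1 - p) \<partial>Q) + ennreal (decrease k \<omega>)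
    \<le> ennreal (\<Phi> k x \<omega>)"
proof -
  let ?g = "\<lambda>s. (norm (forward_step k \<omega> s - x))\<^sup>2"
  let ?r = "(1 - \<alpha>) / p * (1 - p) * (norm (w k \<omega> - x))\<^sup>2"
  have r: "0 \<le> ?r" using \<alpha> p by simp
  have g: "integrable Q ?g"
    unfolding forward_step_def by (rule Q.corrected_step_integrable)
  have average: "\<Psi> s (forward_step k \<omega> s) * p + \<Psi> s (w k \<omega>) * (1 - p) = ennreal (?g s + ?r)" for s
  proof -
    have nn: "0 \<le> \<alpha> * ?g s + (1 - \<alpha>) / p * (norm (y - x))\<^sup>2" for y
      using \<alpha> p by simp
    have "\<Psi> s (forward_step k \<omega> s) * p + \<Psi> s (w k \<omega>) * (1 - p)
        = ennreal ((\<alpha> * ?g s + (1 - \<alpha>) / p * ?g s) * p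
            + (\<alpha> * ?g s + (1 - \<alpha>) / p * (norm (w k \<omega> - x))\<^sup>2) * (1 - p))"
      unfolding \<Psi>_def using nn[of "forward_step k \<omega> s"] nn[of "w k \<omega>"] p
      by (simp add: ennreal_mult[symmetric] ennreal_plus[symmetric] del: ennreal_plus)
    also have "(\<alpha> * ?g s + (1 - \<alpha>) / p * ?g s) * p
            + (\<alpha> * ?g s + (1 - \<alpha>) / p * (norm (w k \<omega> - x))\<^sup>2) * (1 - p) = ?g s + ?r"
      using p by (simp add: field_simps)
    finally show ?thesis .
  qed
  have "(\<integral>\<^sup>+ s. \<Psi> s (forward_step k \<omega> s) * p + \<Psi> s (w k \<omega>) * (1 - p) \<partial>Q)
      = ennreal (\<integral>s. ?g s + ?r \<partial>Q)"
    unfolding average using g r by (intro nn_integral_eq_integral) auto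
  also have "(\<integral>s. ?g s + ?r \<partial>Q) = (\<integral>s. ?g s \<partial>Q) + ?r"
    using g by (simp add: Q.prob_space)
  finally have eq: "(\<integral>\<^sup>+ s. \<Psi> s (forward_step k \<omega> s) * p + \<Psi> s (w k \<omega>) * (1 - p) \<partial>Q)
      = ennreal ((\<integral>s. ?g s \<partial>Q) + ?r)" .
  have "(\<integral>s. ?g s \<partial>Q) + ?r + decrease k \<omega>
      \<le> \<alpha> * (norm (z k \<omega> - x))\<^sup>2 + (1 - \<alpha>) * (norm (w k \<omega> - x))\<^sup>2 + ?r"
    using forward_step_second_moment[OF x \<omega>, of k] by simp
  also have "\<dots> = \<Phi> k x \<omega>"
    using p by (simp add: lyapunov_def field_simps)
  finally have le: "(\<integral>s. ?g s \<partial>Q) + ?r + decrease k \<omega> \<le> \<Phi> k x \<omega>" .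
  have "0 \<le> (\<integral>s. ?g s \<partial>Q) + ?r" using r by (intro add_nonneg_nonneg) auto
  then show ?thesis
    unfolding eq using le decrease_nonneg by (simp add: ennreal_leI flip: ennreal_plus)
qed

text \<open>The comparison point \<open>X\<close> may itself be random, as long as it is known before the draw. This
  generality is what allows the maximal inequality to be restarted at a solution close to the current
  reference point.\<close>

lemma \<Phi>_supermartingale:
  assumes X [measurable]: "X \<in> borel_measurable (past k)"
    and sol: "\<And>\<omega>. \<omega> \<in> space M \<Longrightarrow> X \<omega> \<in> solution_set F G"
    and A [measurable]: "A \<in> sets (past k)"
  shows "(\<integral>\<^sup>+ \<omega>. ennreal (\<Phi> (Suc k) (X \<omega>) \<omega>) * indicator A \<omega> \<partial>M)
      + (\<integral>\<^sup>+ \<omega>. ennreal (decrease k \<omega>) * indicator A \<omega> \<partial>M)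
    \<le> (\<integral>\<^sup>+ \<omega>. ennreal (\<Phi> k (X \<omega>) \<omega>) * indicator A \<omega> \<partial>M)"
proof -
  note forward_step_measurable[of k, measurable]
  define \<Psi> where "\<Psi> \<omega> s y = ennreal (\<alpha> * (norm (forward_step k \<omega> s - X \<omega>))\<^sup>2
      + (1 - \<alpha>) / p * (norm (y - X \<omega>))\<^sup>2)" for \<omega> s y
  define f where "f q = \<Psi> (fst q) (fst (snd q))
      (if snd (snd q) then forward_step k (fst q) (fst (snd q)) else w k (fst q)) * indicator A (fst q)" for q
  define I where "I \<omega> = (\<integral>\<^sup>+ s. f (\<omega>, s, True) * p + f (\<omega>, s, False) * (1 - p) \<partial>Q)" for \<omega>
  have f: "f \<in> borel_measurable (past k \<Otimes>\<^sub>M draw_space)"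
    unfolding f_def \<Psi>_def by measurable
  have AM [measurable]: "A \<in> sets M" using A subalgebra_past[of k] by (auto simp: subalgebra_def)
  have "(\<integral>\<^sup>+ \<omega>. ennreal (\<Phi> (Suc k) (X \<omega>) \<omega>) * indicator A \<omega> \<partial>M) = (\<integral>\<^sup>+ \<omega>. f (\<omega>, \<xi> k \<omega>, c k \<omega>) \<partial>M)"
    by (intro nn_integral_cong)
      (simp add: f_def \<Psi>_def lyapunov_def z_Suc w_Suc forward_step_def)
  also have "\<dots> = (\<integral>\<^sup>+ \<omega>. \<integral>\<^sup>+ s. f (\<omega>, s, True) * p + f (\<omega>, s, False) * (1 - p) \<partial>Q \<partial>M)"
    by (rule nn_integral_next_draw[OF f])
  finally have eq: "(\<integral>\<^sup>+ \<omega>. ennreal (\<Phi> (Suc k) (X \<omega>) \<omega>) * indicator A \<omega> \<partial>M) = (\<integral>\<^sup>+ \<omega>. I \<omega> \<partial>M)"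
    by (simp add: I_def)
  have "(\<lambda>(\<omega>, s). f (\<omega>, s, True) * p + f (\<omega>, s, False) * (1 - p)) \<in> borel_measurable (past k \<Otimes>\<^sub>M Q)"
    using f by measurable
  then have "I \<in> borel_measurable (past k)"
    unfolding I_def by (rule Q.borel_measurable_nn_integral)
  then have [measurable]: "I \<in> borel_measurable M" by (rule measurable_past_M)
  have "(\<integral>\<^sup>+ \<omega>. I \<omega> \<partial>M) + (\<integral>\<^sup>+ \<omega>. ennreal (decrease k \<omega>) * indicator A \<omega> \<partial>M)
      = (\<integral>\<^sup>+ \<omega>. I \<omega> + ennreal (decrease k \<omega>) * indicator A \<omega> \<partial>M)"
    by (intro nn_integral_add[symmetric]) auto
  also have "\<dots> \<le> (\<integral>\<^sup>+ \<omega>. ennreal (\<Phi> k (X \<omega>) \<omega>) * indicator A \<omega> \<partial>M)"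
  proof (rule nn_integral_mono)
    fix \<omega> assume \<omega>: "\<omega> \<in> space M"
    show "I \<omega> + ennreal (decrease k \<omega>) * indicator A \<omega> \<le> ennreal (\<Phi> k (X \<omega>) \<omega>) * indicator A \<omega>"
      using next_draw_descent[OF sol[OF \<omega>] \<omega>, of k]
      by (cases "\<omega> \<in> A") (simp_all add: I_def f_def \<Psi>_def)
  qed
  finally show ?thesis unfolding eq .
qed

lemma mean_\<Phi>_plus_decreases_le:
  assumes x: "x \<in> solution_set F G"
  shows "(\<integral>\<^sup>+ \<omega>. ennreal (\<Phi> n x \<omega>) \<partial>M) + (\<Sum>k<n. \<integral>\<^sup>+ \<omega>. ennreal (decrease k \<omega>) \<partial>M)
    \<le> ennreal ((\<alpha> + (1 - \<alpha>) / p) * (norm (z0 - x))\<^sup>2)"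
proof (induction n)
  case 0
  have "(\<integral>\<^sup>+ \<omega>. ennreal (\<Phi> 0 x \<omega>) \<partial>M) = (\<integral>\<^sup>+ \<omega>. ennreal ((\<alpha> + (1 - \<alpha>) / p) * (norm (z0 - x))\<^sup>2) \<partial>M)"
    by (intro nn_integral_cong) (simp add: lyapunov_def iterates_0 algebra_simps)
  then show ?case by (simp add: emeasure_space_1)
next
  case (Suc n)
  have "(\<integral>\<^sup>+ \<omega>. ennreal (\<Phi> (Suc n) x \<omega>) \<partial>M) + (\<integral>\<^sup>+ \<omega>. ennreal (decrease n \<omega>) \<partial>M)
      \<le> (\<integral>\<^sup>+ \<omega>. ennreal (\<Phi> n x \<omega>) \<partial>M)"
    using \<Phi>_supermartingale[of "\<lambda>_. x" n "space M"] x sets.top[of "past n"]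
    by (simp cong: nn_integral_cong)
  have "(\<integral>\<^sup>+ \<omega>. ennreal (\<Phi> (Suc n) x \<omega>) \<partial>M) + (\<Sum>k<Suc n. \<integral>\<^sup>+ \<omega>. ennreal (decrease k \<omega>) \<partial>M)
      = (\<integral>\<^sup>+ \<omega>. ennreal (\<Phi> (Suc n) x \<omega>) \<partial>M) + (\<integral>\<^sup>+ \<omega>. ennreal (decrease n \<omega>) \<partial>M)
      + (\<Sum>k<n. \<integral>\<^sup>+ \<omega>. ennreal (decrease k \<omega>) \<partial>M)"
    by (simp add: ac_simps)
  also have "\<dots> \<le> (\<integral>\<^sup>+ \<omega>. ennreal (\<Phi> n x \<omega>) \<partial>M) + (\<Sum>k<n. \<integral>\<^sup>+ \<omega>. ennreal (decrease k \<omega>) \<partial>M)"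
    by (rule add_right_mono) fact
  finally show ?case using Suc.IH by (rule order_trans)
qed

lemma \<Phi>_integrable:
  assumes x: "x \<in> solution_set F G"
  shows "integrable M (\<Phi> k x)"
proof (rule integrableI_bounded)
  show "\<Phi> k x \<in> borel_measurable M" using \<Phi>_M[of "\<lambda>_. x" k] by simp
  have "(\<integral>\<^sup>+ \<omega>. ennreal (\<Phi> k x \<omega>) \<partial>M)
      \<le> (\<integral>\<^sup>+ \<omega>. ennreal (\<Phi> k x \<omega>) \<partial>M) + (\<Sum>k<k. \<integral>\<^sup>+ \<omega>. ennreal (decrease k \<omega>) \<partial>M)"
    by simp
  also have "\<dots> < \<infinity>"
    using mean_\<Phi>_plus_decreases_le[OF x] by (rule le_less_trans) simp
  finally show "(\<integral>\<^sup>+ \<omega>. ennreal (norm (\<Phi> k x \<omega>)) \<partial>M) < \<infinity>"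
    by (simp add: \<Phi>_nonneg)
qed

text \<open>The history is contained in the past, so every event of the history is allowed in the
  supermartingale inequality.\<close>

lemma \<Phi>_cond_exp_le:
  assumes x: "x \<in> solution_set F G"
  shows "AE \<omega> in M. real_cond_exp M (history k) (\<Phi> (Suc k) x) \<omega> \<le> \<Phi> k x \<omega>"
proof -
  interpret H: finite_measure_subalgebra M "history k"
    by unfold_locales (rule subalgebra_history)
  show ?thesis
  proof (rule H.real_cond_exp_le[OF \<Phi>_integrable[OF x] \<Phi>_integrable[OF x]])
    have [measurable]: "z k \<in> borel_measurable (history k)" "w k \<in> borel_measurable (history k)"
      by (auto intro: z_history w_history)
    show "\<Phi> k x \<in> borel_measurable (history k)"
      unfolding lyapunov_def[abs_def] by measurable
    fix A assume "A \<in> sets (history k)"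
    then have A: "A \<in> sets (past k)" and AM: "A \<in> sets M"
      using sets_history_subset_past[of k] subalgebra_history[of k] by (auto simp: subalgebra_def)
    have set_integral: "(\<integral>\<omega>\<in>A. \<Phi> j x \<omega> \<partial>M) = enn2real (\<integral>\<^sup>+ \<omega>. ennreal (\<Phi> j x \<omega>) * indicator A \<omega> \<partial>M)"
      for j
    proof -
      have "(\<integral>\<omega>\<in>A. \<Phi> j x \<omega> \<partial>M) = enn2real (\<integral>\<^sup>+ \<omega>. ennreal (indicator A \<omega> *\<^sub>R \<Phi> j x \<omega>) \<partial>M)"
        unfolding set_lebesgue_integral_def
        using AM \<Phi>_M[of "\<lambda>_. x" j] by (intro integral_eq_nn_integral) (auto simp: \<Phi>_nonneg)
      also have "(\<integral>\<^sup>+ \<omega>. ennreal (indicator A \<omega> *\<^sub>R \<Phi> j x \<omega>) \<partial>M)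
          = (\<integral>\<^sup>+ \<omega>. ennreal (\<Phi> j x \<omega>) * indicator A \<omega> \<partial>M)"
        by (intro nn_integral_cong) (simp split: split_indicator)
      finally show ?thesis .
    qed
    have "(\<integral>\<^sup>+ \<omega>. ennreal (\<Phi> (Suc k) x \<omega>) * indicator A \<omega> \<partial>M)
        \<le> (\<integral>\<^sup>+ \<omega>. ennreal (\<Phi> k x \<omega>) * indicator A \<omega> \<partial>M)"
      using \<Phi>_supermartingale[of "\<lambda>_. x" k A] x A by (auto intro: order_trans[rotated])
    moreover have "(\<integral>\<^sup>+ \<omega>. ennreal (\<Phi> k x \<omega>) * indicator A \<omega> \<partial>M) < \<infinity>"
    proof -
      have "(\<integral>\<^sup>+ \<omega>. ennreal (\<Phi> k x \<omega>) * indicator A \<omega> \<partial>M) \<le> (\<integral>\<^sup>+ \<omega>. ennreal (norm (\<Phi> k x \<omega>)) \<partial>M)"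
        by (intro nn_integral_mono) (auto simp: \<Phi>_nonneg split: split_indicator)
      also have "\<dots> < \<infinity>" using \<Phi>_integrable[OF x, of k] by (simp add: integrable_iff_bounded)
      finally show ?thesis .
    qed
    ultimately show "(\<integral>\<omega>\<in>A. \<Phi> (Suc k) x \<omega> \<partial>M) \<le> (\<integral>\<omega>\<in>A. \<Phi> k x \<omega> \<partial>M)"
      unfolding set_integral by (intro enn2real_mono) auto
  qed
qed

section \<open>Almost sure convergence\<close>

lemma AE_decrease_tendsto_0:
  assumes "solution_set F G \<noteq> {}"
  shows "AE \<omega> in M. (\<lambda>k. decrease k \<omega>) \<longlonglongrightarrow> 0"
proof -
  obtain x where x: "x \<in> solution_set F G" using assms by blast
  show ?thesis
  proof (rule AE_tendsto_0_if_summable_means[OF decrease_M decrease_nonneg])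
    show "(\<Sum>k<n. \<integral>\<^sup>+ \<omega>. ennreal (decrease k \<omega>) \<partial>M) \<le> ennreal ((\<alpha> + (1 - \<alpha>) / p) * (norm (z0 - x))\<^sup>2)" for n
      using mean_\<Phi>_plus_decreases_le[OF x, of n] by (auto intro: order_trans[rotated])
  qed simp
qed

text \<open>The last correction is controlled by the same surplus, because its second moment is at most
  $\tau^2L^2\|z_{k+1/2}-w_k\|^2$. Hence $z_{k+1}$ and $w_k$ become close as well, even for
  $\alpha = 0$, where the surplus says nothing about $z_k$.\<close>

lemma correction_mean_le:
  "(\<integral>\<^sup>+ \<omega>. ennreal ((norm (z (Suc k) \<omega> - zh k \<omega>))\<^sup>2) \<partial>M)
    \<le> ennreal (\<gamma>\<^sup>2 / (1 - \<gamma>\<^sup>2)) * (\<integral>\<^sup>+ \<omega>. ennreal (decrease k \<omega>) \<partial>M)"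
proof -
  note forward_step_measurable[of k, measurable]
  define g where "g \<omega> s = ennreal ((norm (forward_step k \<omega> s - zh k \<omega>))\<^sup>2)" for \<omega> s
  have f: "(\<lambda>q. g (fst q) (fst (snd q))) \<in> borel_measurable (past k \<Otimes>\<^sub>M draw_space)"
    unfolding g_def by measurable
  have g_le: "(\<integral>\<^sup>+ s. g \<omega> s \<partial>Q) \<le> ennreal (\<gamma>\<^sup>2 / (1 - \<gamma>\<^sup>2) * decrease k \<omega>)" for \<omega>
  proof -
    let ?D = "\<lambda>s. (norm (F\<xi> s (zh k \<omega>) - F\<xi> s (w k \<omega>)))\<^sup>2"
    have "(\<integral>\<^sup>+ s. g \<omega> s \<partial>Q) = (\<integral>\<^sup>+ s. ennreal (\<tau>\<^sup>2 * ?D s) \<partial>Q)"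
      by (simp add: g_def forward_step_def power_mult_distrib)
    also have "\<dots> = ennreal (\<tau>\<^sup>2 * (\<integral>s. ?D s \<partial>Q))"
      by (subst nn_integral_eq_integral) (auto simp: Q.oracle_diff_square_integrable)
    also have "\<dots> \<le> ennreal (\<gamma>\<^sup>2 / (1 - \<gamma>\<^sup>2) * decrease k \<omega>)"
    proof (rule ennreal_leI)
      have "\<tau>\<^sup>2 * (\<integral>s. ?D s \<partial>Q) \<le> \<tau>\<^sup>2 * (L\<^sup>2 * (norm (zh k \<omega> - w k \<omega>))\<^sup>2)"
        by (intro mult_left_mono Q.oracle_diff_second_moment) simp
      also have "\<dots> = \<gamma>\<^sup>2 / (1 - \<gamma>\<^sup>2) * ((1 - \<alpha>) * (1 - \<gamma>\<^sup>2) * (norm (w k \<omega> - zh k \<omega>))\<^sup>2)"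
        using gap_pos by (simp add: mult.assoc[symmetric] \<tau>_L norm_minus_commute)
      also have "\<dots> \<le> \<gamma>\<^sup>2 / (1 - \<gamma>\<^sup>2) * decrease k \<omega>"
        using gap_pos \<alpha> by (intro mult_left_mono) (auto simp: decrease_def)
      finally show "\<tau>\<^sup>2 * (\<integral>s. ?D s \<partial>Q) \<le> \<gamma>\<^sup>2 / (1 - \<gamma>\<^sup>2) * decrease k \<omega>" .
    qed
    finally show ?thesis .
  qed
  have average: "g \<omega> s * p + g \<omega> s * (1 - p) = g \<omega> s" for \<omega> s
    using p unfolding distrib_left[symmetric] by (simp flip: ennreal_plus)
  have "(\<integral>\<^sup>+ \<omega>. ennreal ((norm (z (Suc k) \<omega> - zh k \<omega>))\<^sup>2) \<partial>M) = (\<integral>\<^sup>+ \<omega>. g \<omega> (\<xi> k \<omega>) \<partial>M)"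
    by (intro nn_integral_cong) (simp add: g_def z_Suc forward_step_def)
  also have "\<dots> = (\<integral>\<^sup>+ \<omega>. \<integral>\<^sup>+ s. g \<omega> s \<partial>Q \<partial>M)"
    using nn_integral_next_draw[OF f] by (simp add: average)
  also have "\<dots> \<le> (\<integral>\<^sup>+ \<omega>. ennreal (\<gamma>\<^sup>2 / (1 - \<gamma>\<^sup>2) * decrease k \<omega>) \<partial>M)"
    by (intro nn_integral_mono g_le)
  also have "\<dots> = ennreal (\<gamma>\<^sup>2 / (1 - \<gamma>\<^sup>2)) * (\<integral>\<^sup>+ \<omega>. ennreal (decrease k \<omega>) \<partial>M)"
  proof -
    have "ennreal (\<gamma>\<^sup>2 / (1 - \<gamma>\<^sup>2) * decrease k \<omega>) = ennreal (\<gamma>\<^sup>2 / (1 - \<gamma>\<^sup>2)) * ennreal (decrease k \<omega>)" for \<omega>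
      by (rule ennreal_mult) (use gap_pos decrease_nonneg in auto)
    then show ?thesis by (simp only: nn_integral_cmult[OF measurable_compose[OF decrease_M measurable_ennreal]])
  qed
  finally show ?thesis .
qed

lemma AE_correction_tendsto_0:
  assumes "solution_set F G \<noteq> {}"
  shows "AE \<omega> in M. (\<lambda>k. z (Suc k) \<omega> - zh k \<omega>) \<longlonglongrightarrow> 0"
proof -
  obtain x where x: "x \<in> solution_set F G" using assms by blast
  let ?C = "ennreal ((\<alpha> + (1 - \<alpha>) / p) * (norm (z0 - x))\<^sup>2)" and ?K = "ennreal (\<gamma>\<^sup>2 / (1 - \<gamma>\<^sup>2))"
  have "AE \<omega> in M. (\<lambda>k. (norm (z (Suc k) \<omega> - zh k \<omega>))\<^sup>2) \<longlonglongrightarrow> 0"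
  proof (rule AE_tendsto_0_if_summable_means)
    fix n
    have "(\<Sum>k<n. \<integral>\<^sup>+ \<omega>. ennreal ((norm (z (Suc k) \<omega> - zh k \<omega>))\<^sup>2) \<partial>M)
        \<le> (\<Sum>k<n. ?K * (\<integral>\<^sup>+ \<omega>. ennreal (decrease k \<omega>) \<partial>M))"
      by (intro sum_mono correction_mean_le)
    also have "\<dots> = ?K * (\<Sum>k<n. \<integral>\<^sup>+ \<omega>. ennreal (decrease k \<omega>) \<partial>M)"
      by (simp add: sum_distrib_left)
    also have "\<dots> \<le> ?K * ?C"
      using mean_\<Phi>_plus_decreases_le[OF x, of n] by (intro mult_left_mono) (auto intro: order_trans[rotated])
    finally show "(\<Sum>k<n. \<integral>\<^sup>+ \<omega>. ennreal ((norm (z (Suc k) \<omega> - zh k \<omega>))\<^sup>2) \<partial>M) \<le> ?K * ?C" .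
  qed (auto simp: ennreal_mult_less_top)
  then show ?thesis
    by eventually_elim (rule tendsto_0_if_norm_square_tendsto_0)
qed

text \<open>Starting the clock at \<open>n\<close> makes \<open>X\<close> known from the first step on, as the
  supermartingale inequality requires.\<close>

lemma \<Phi>_maximal_inequality:
  assumes X: "X \<in> borel_measurable (past n)"
    and sol: "\<And>\<omega>. \<omega> \<in> space M \<Longrightarrow> X \<omega> \<in> solution_set F G"
  shows "l * emeasure M {\<omega> \<in> space M. \<exists>k. l \<le> ennreal (\<Phi> (n + k) (X \<omega>) \<omega>)}
    \<le> (\<integral>\<^sup>+ \<omega>. min (ennreal (\<Phi> n (X \<omega>) \<omega>)) l \<partial>M)"
proof -
  have X': "X \<in> borel_measurable (past (n + k))" for k
    by (rule measurable_past_mono[OF _ X]) simp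
  define V where "V k \<omega> = ennreal (\<Phi> (n + k) (X \<omega>) \<omega>)" for k \<omega>
  have "l * emeasure M {\<omega> \<in> space M. \<exists>k. l \<le> V k \<omega>} \<le> (\<integral>\<^sup>+ \<omega>. min (V 0 \<omega>) l \<partial>M)"
  proof (rule nonneg_supermartingale_maximal_inequality[where N = "\<lambda>k. past (n + k)"])
    show "subalgebra M (past (n + k))" for k by (rule subalgebra_past)
    show "sets (past (n + k)) \<subseteq> sets (past (n + Suc k))" for k by (rule past_mono) simp
    show "V k \<in> borel_measurable (past (n + k))" for k
      unfolding V_def using \<Phi>_past_measurable[OF X'] by (rule measurable_compose) simp
    show "(\<integral>\<^sup>+ \<omega>. V (Suc k) \<omega> * indicator A \<omega> \<partial>M) \<le> (\<integral>\<^sup>+ \<omega>. V k \<omega> * indicator A \<omega> \<partial>M)"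
      if "A \<in> sets (past (n + k))" for k A
      using \<Phi>_supermartingale[OF X' sol that] unfolding V_def
      by (auto intro: order_trans[rotated])
  qed
  then show ?thesis by (simp add: V_def)
qed

text \<open>The mean of \<open>\<Phi> 0 x\<close> is finite, so by the maximal inequality the probability of ever reaching
  level \<open>m\<close> is of order \<open>1 / m\<close>.\<close>

lemma AE_\<Phi>_bounded:
  assumes x: "x \<in> solution_set F G"
  shows "AE \<omega> in M. \<exists>m::nat. \<forall>k. \<Phi> k x \<omega> < real m"
proof -
  let ?C = "(\<alpha> + (1 - \<alpha>) / p) * (norm (z0 - x))\<^sup>2"
  define E where "E = {\<omega> \<in> space M. \<forall>m::nat. \<exists>k. real m \<le> \<Phi> k x \<omega>}"
  have [measurable]: "\<Phi> k x \<in> borel_measurable M" for k using \<Phi>_M[of "\<lambda>_. x" k] by simp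
  have E [measurable]: "E \<in> sets M" unfolding E_def by measurable
  have C: "0 \<le> ?C" using \<alpha> p by simp
  have le: "real m * prob E \<le> ?C" for m
  proof -
    let ?E = "{\<omega> \<in> space M. \<exists>k. ennreal (real m) \<le> ennreal (\<Phi> k x \<omega>)}"
    have "ennreal (real m) * emeasure M E \<le> ennreal (real m) * emeasure M ?E"
      by (intro mult_left_mono emeasure_mono) (auto simp: E_def \<Phi>_nonneg)
    also have "\<dots> \<le> (\<integral>\<^sup>+ \<omega>. min (ennreal (\<Phi> 0 x \<omega>)) (real m) \<partial>M)"
      using \<Phi>_maximal_inequality[of "\<lambda>_. x" 0 "ennreal (real m)"] x by simp
    also have "\<dots> \<le> (\<integral>\<^sup>+ \<omega>. ennreal (\<Phi> 0 x \<omega>) \<partial>M)"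
      by (intro nn_integral_mono) simp
    also have "\<dots> \<le> ennreal ?C"
      using mean_\<Phi>_plus_decreases_le[OF x, of 0] by simp
    finally show ?thesis
      using C by (simp add: emeasure_eq_measure ennreal_mult'[symmetric] ennreal_le_iff)
  qed
  have "prob E = 0"
  proof (rule ccontr)
    assume "prob E \<noteq> 0"
    then have "0 < prob E" using measure_nonneg[of M E] by linarith
    then obtain m where "?C < real m * prob E" using ex_less_of_nat_mult by blast
    then show False using le[of m] by simp
  qed
  then have "AE \<omega> in M. \<omega> \<notin> E"
    by (intro AE_not_in) (simp add: null_sets_def emeasure_eq_measure)
  then show ?thesis
    by (rule AE_mp) (auto intro!: AE_I2 simp: E_def not_le)
qed

lemma \<Phi>_bounded_imp_w_bounded:
  assumes "\<And>k. \<Phi> k x \<omega> < B"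
  shows "bounded (range (\<lambda>k. w k \<omega>))"
proof (rule boundedI, safe)
  fix k
  have "(1 - \<alpha>) / p * (norm (w k \<omega> - x))\<^sup>2 \<le> \<Phi> k x \<omega>"
    using \<alpha> by (simp add: lyapunov_def)
  also have "\<dots> \<le> B" using assms[of k] by simp
  finally have "(norm (w k \<omega> - x))\<^sup>2 \<le> B * p / (1 - \<alpha>)"
    using \<alpha> p by (simp add: field_simps)
  then have "norm (w k \<omega> - x) \<le> sqrt (B * p / (1 - \<alpha>))"
    by (rule real_le_rsqrt)
  then show "norm (w k \<omega>) \<le> norm x + sqrt (B * p / (1 - \<alpha>))"
    using norm_triangle_sub[of "w k \<omega>" x] by linarith
qed

text \<open>The factor \<open>sqrt \<alpha>\<close> covers the case \<open>\<alpha> = 0\<close>, in which the distance of \<open>z k\<close> from the half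
  step need not tend to zero.\<close>

lemma
  assumes decrease: "(\<lambda>k. decrease k \<omega>) \<longlonglongrightarrow> 0"
  shows w_minus_zh_tendsto_0: "(\<lambda>k. w k \<omega> - zh k \<omega>) \<longlonglongrightarrow> 0"
    and scaled_z_minus_zh_tendsto_0: "(\<lambda>k. sqrt \<alpha> *\<^sub>R (z k \<omega> - zh k \<omega>)) \<longlonglongrightarrow> 0"
proof -
  define C where "C = (1 - \<alpha>) * (1 - \<gamma>\<^sup>2)"
  have C: "0 < C" using \<alpha> gap_pos by (simp add: C_def)
  have "(\<lambda>k. inverse C * decrease k \<omega>) \<longlonglongrightarrow> inverse C * 0"
    by (intro tendsto_mult tendsto_const decrease)
  then have lim: "(\<lambda>k. inverse C * decrease k \<omega>) \<longlonglongrightarrow> 0" by simp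
  have w_le: "(norm (w k \<omega> - zh k \<omega>))\<^sup>2 \<le> inverse C * decrease k \<omega>" for k
  proof -
    have "(norm (w k \<omega> - zh k \<omega>))\<^sup>2 = inverse C * (C * (norm (w k \<omega> - zh k \<omega>))\<^sup>2)"
      using C by simp
    also have "\<dots> \<le> inverse C * decrease k \<omega>"
      using C \<alpha> by (intro mult_left_mono) (auto simp: decrease_def C_def[symmetric])
    finally show ?thesis .
  qed
  have z_le: "(norm (sqrt \<alpha> *\<^sub>R (z k \<omega> - zh k \<omega>)))\<^sup>2 \<le> decrease k \<omega>" for k
    using C \<alpha> by (simp add: decrease_def C_def[symmetric] power_mult_distrib)
  show "(\<lambda>k. w k \<omega> - zh k \<omega>) \<longlonglongrightarrow> 0"
    by (rule tendsto_0_if_norm_square_tendsto_0, rule tendsto_sandwich[OF _ _ tendsto_const lim])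
      (simp_all only: w_le zero_le_power2 eventually_True)
  show "(\<lambda>k. sqrt \<alpha> *\<^sub>R (z k \<omega> - zh k \<omega>)) \<longlonglongrightarrow> 0"
    by (rule tendsto_0_if_norm_square_tendsto_0, rule tendsto_sandwich[OF _ _ tendsto_const decrease])
      (simp_all only: z_le zero_le_power2 eventually_True)
qed

text \<open>Along the subsequence the half steps share the limit \<open>y\<close> of the reference points, and the
  elements of \<open>G\<close> that the resolvent provides at the half steps tend to \<open>- F y\<close>; the graph of \<open>G\<close>
  is closed.\<close>

lemma cluster_point_in_solution_set:
  assumes \<omega>: "\<omega> \<in> space M" and decrease: "(\<lambda>k. decrease k \<omega>) \<longlonglongrightarrow> 0"
    and r: "strict_mono r" and y: "(\<lambda>n. w (r n) \<omega>) \<longlonglongrightarrow> y"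
  shows "y \<in> solution_set F G"
proof -
  note sub = LIMSEQ_subseq_LIMSEQ[OF _ r, unfolded o_def]
  have d: "(\<lambda>n. w (r n) \<omega> - zh (r n) \<omega>) \<longlonglongrightarrow> 0"
    by (rule sub[OF w_minus_zh_tendsto_0[OF decrease]])
  have zh: "(\<lambda>n. zh (r n) \<omega>) \<longlonglongrightarrow> y"
    using tendsto_diff[OF y d] by simp
  have Fw: "(\<lambda>n. F (w (r n) \<omega>)) \<longlonglongrightarrow> F y"
    using continuous_on_tendsto_compose[OF Q.mean_continuous y] by simp
  define u where "u n = (1 / \<tau>) *\<^sub>R (sqrt \<alpha> *\<^sub>R (sqrt \<alpha> *\<^sub>R (z (r n) \<omega> - zh (r n) \<omega>))
      + (1 - \<alpha>) *\<^sub>R (w (r n) \<omega> - zh (r n) \<omega>)) - F (w (r n) \<omega>)" for n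
  \<comment> \<open>\<open>\<alpha>\<close> is split as \<open>sqrt \<alpha> * sqrt \<alpha>\<close> because only \<open>sqrt \<alpha>\<close> times the difference is known to vanish.\<close>
  have "u \<longlonglongrightarrow> (1 / \<tau>) *\<^sub>R (sqrt \<alpha> *\<^sub>R 0 + (1 - \<alpha>) *\<^sub>R 0) - F y"
    unfolding u_def[abs_def]
    by (intro tendsto_intros Fw d sub[OF scaled_z_minus_zh_tendsto_0[OF decrease]])
  then have u: "u \<longlonglongrightarrow> - F y" by simp
  have "u n \<in> G (zh (r n) \<omega>)" for n
  proof -
    have "u n = (1 / \<tau>) *\<^sub>R (\<alpha> *\<^sub>R z (r n) \<omega> + (1 - \<alpha>) *\<^sub>R w (r n) \<omega> - \<tau> *\<^sub>R F (w (r n) \<omega>) - zh (r n) \<omega>)"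
      using \<tau>_pos \<alpha> by (simp add: u_def algebra_simps)
    then show ?thesis
      using zh_mem[OF \<omega>, of "r n"] \<tau>_pos by (simp add: mem_resolvent_scale_iff)
  qed
  then have "- F y \<in> G y"
    by (rule maximally_monotone_closed_graph[OF G zh u])
  then show ?thesis by (simp add: mem_solution_set_iff)
qed

text \<open>The reference points stay bounded and all their cluster points are solutions, so their
  distance to the solution set vanishes; the points \<open>z\<close> are close to them up to the factor
  \<open>sqrt \<alpha>\<close>, which is exactly how they enter \<open>\<Phi>\<close>.\<close>

lemma \<Phi>_near_projection_tendsto_0:
  assumes \<omega>: "\<omega> \<in> space M" and decrease: "(\<lambda>k. decrease k \<omega>) \<longlonglongrightarrow> 0"
    and bounded: "bounded (range (\<lambda>k. w k \<omega>))"
    and X: "\<And>n. dist (w n \<omega>) (X n) < infdist (w n \<omega>) (solution_set F G) + 1 / real (Suc n)"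
  shows "(\<lambda>n. \<Phi> n (X n) \<omega>) \<longlonglongrightarrow> 0"
proof -
  have "(\<lambda>n. infdist (w n \<omega>) (solution_set F G)) \<longlonglongrightarrow> 0"
    by (rule infdist_tendsto_0_if_cluster_points_mem[OF bounded])
      (rule cluster_point_in_solution_set[OF \<omega> decrease])
  then have "(\<lambda>n. infdist (w n \<omega>) (solution_set F G) + 1 / real (Suc n)) \<longlonglongrightarrow> 0 + 0"
    by (intro tendsto_add LIMSEQ_Suc[OF lim_1_over_n])
  then have "(\<lambda>n. infdist (w n \<omega>) (solution_set F G) + 1 / real (Suc n)) \<longlonglongrightarrow> 0" by simp
  then have "(\<lambda>n. norm (w n \<omega> - X n)) \<longlonglongrightarrow> 0"
    by (rule tendsto_sandwich[OF _ _ tendsto_const, rotated 2])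
      (use X in \<open>auto simp: dist_norm intro!: always_eventually less_imp_le\<close>)
  then have wX: "(\<lambda>n. w n \<omega> - X n) \<longlonglongrightarrow> 0" by (rule tendsto_norm_zero_cancel)
  have "(\<lambda>n. sqrt \<alpha> *\<^sub>R (z n \<omega> - zh n \<omega>) - sqrt \<alpha> *\<^sub>R (w n \<omega> - zh n \<omega>) + sqrt \<alpha> *\<^sub>R (w n \<omega> - X n))
      \<longlonglongrightarrow> 0 - sqrt \<alpha> *\<^sub>R 0 + sqrt \<alpha> *\<^sub>R 0"
    by (intro tendsto_intros wX w_minus_zh_tendsto_0 scaled_z_minus_zh_tendsto_0 decrease)
  then have zX: "(\<lambda>n. sqrt \<alpha> *\<^sub>R (z n \<omega> - X n)) \<longlonglongrightarrow> 0"
    by (simp add: algebra_simps)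
  have "(\<lambda>n. (norm (sqrt \<alpha> *\<^sub>R (z n \<omega> - X n)))\<^sup>2 + (1 - \<alpha>) / p * (norm (w n \<omega> - X n))\<^sup>2)
      \<longlonglongrightarrow> (norm (0::'a))\<^sup>2 + (1 - \<alpha>) / p * (norm (0::'a))\<^sup>2"
    by (intro tendsto_intros zX wX)
  then show ?thesis
    using \<alpha> by (simp add: lyapunov_def power_mult_distrib)
qed

text \<open>For every \<open>n\<close> the event of never being trapped is part of the event that \<open>\<Phi>\<close>, restarted
  at time \<open>n\<close> with the point \<open>X n\<close>, reaches \<open>l\<close>. By the maximal inequality the probability of
  the latter is at most the mean of $\min(\Phi_n(X_n), l)/l$, which tends to zero.\<close>

lemma AE_eventually_trapped:
  assumes X: "\<And>n. X n \<in> borel_measurable (past n)"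
    and sol: "\<And>n \<omega>. \<omega> \<in> space M \<Longrightarrow> X n \<omega> \<in> solution_set F G"
    and lim: "AE \<omega> in M. (\<lambda>n. \<Phi> n (X n \<omega>) \<omega>) \<longlonglongrightarrow> 0"
    and l: "0 < l"
  shows "AE \<omega> in M. \<exists>n. \<forall>k. \<Phi> (n + k) (X n \<omega>) \<omega> < l"
proof -
  have [measurable]: "X n \<in> borel_measurable M" for n by (rule measurable_past_M[OF X])
  define E where "E n = {\<omega> \<in> space M. \<exists>k. ennreal l \<le> ennreal (\<Phi> (n + k) (X n \<omega>) \<omega>)}" for n
  have [measurable]: "E n \<in> sets M" for n unfolding E_def by measurable
  have "(\<lambda>n. \<integral>\<^sup>+ \<omega>. min (ennreal (\<Phi> n (X n \<omega>) \<omega>)) (ennreal l) \<partial>M) \<longlonglongrightarrow> (\<integral>\<^sup>+ \<omega>. 0 \<partial>M)"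
  proof (rule nn_integral_dominated_convergence[where w = "\<lambda>_. ennreal l"])
    show "AE \<omega> in M. (\<lambda>n. min (ennreal (\<Phi> n (X n \<omega>) \<omega>)) (ennreal l)) \<longlonglongrightarrow> 0"
      using lim
    proof eventually_elim
      case (elim \<omega>)
      have "(\<lambda>n. ennreal (\<Phi> n (X n \<omega>) \<omega>)) \<longlonglongrightarrow> 0" using tendsto_ennrealI[OF elim] by simp
      then have "(\<lambda>n. min (ennreal (\<Phi> n (X n \<omega>) \<omega>)) (ennreal l)) \<longlonglongrightarrow> min 0 (ennreal l)"
        by (intro tendsto_min tendsto_const)
      then show ?case by simp
    qed
  qed (auto simp: emeasure_space_1)
  moreover have "ennreal l * emeasure M (\<Inter>n. E n)
      \<le> (\<integral>\<^sup>+ \<omega>. min (ennreal (\<Phi> n (X n \<omega>) \<omega>)) (ennreal l) \<partial>M)" for n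
  proof -
    have "ennreal l * emeasure M (\<Inter>n. E n) \<le> ennreal l * emeasure M (E n)"
      by (intro mult_left_mono emeasure_mono) auto
    also have "\<dots> \<le> (\<integral>\<^sup>+ \<omega>. min (ennreal (\<Phi> n (X n \<omega>) \<omega>)) (ennreal l) \<partial>M)"
      unfolding E_def by (rule \<Phi>_maximal_inequality[OF X sol])
    finally show ?thesis .
  qed
  ultimately have "ennreal l * emeasure M (\<Inter>n. E n) \<le> 0"
    by (intro LIMSEQ_le_const[of _ 0]) auto
  then have "emeasure M (\<Inter>n. E n) = 0" using l by simp
  then have "AE \<omega> in M. \<omega> \<notin> (\<Inter>n. E n)"
    by (intro AE_not_in) (simp add: null_sets_def)
  then show ?thesis
    by (rule AE_mp) (auto intro!: AE_I2 simp: E_def not_le \<Phi>_nonneg ennreal_less_iff)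
qed

text \<open>From time \<open>n\<close> on, all reference points lie in a small ball around the one point \<open>X n\<close>.\<close>

lemma w_Cauchy:
  assumes trapped: "\<And>m. \<exists>n. \<forall>k. \<Phi> (n + k) (X n) \<omega> < 1 / real (Suc m)"
  shows "Cauchy (\<lambda>k. w k \<omega>)"
proof (rule metric_CauchyI)
  fix e :: real assume e: "0 < e"
  have pos: "0 < (1 - \<alpha>) / p" using \<alpha> p by simp
  then have "0 < (1 - \<alpha>) / p * (e / 2)\<^sup>2" by (rule mult_pos_pos) (use e in simp)
  then obtain m where m: "1 / real (Suc m) < (1 - \<alpha>) / p * (e / 2)\<^sup>2"
    using nat_approx_posE by blast
  obtain n where n: "\<And>k. \<Phi> (n + k) (X n) \<omega> < 1 / real (Suc m)" using trapped by blast
  have close: "dist (w j \<omega>) (X n) < e / 2" if "n \<le> j" for j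
  proof -
    have "(1 - \<alpha>) / p * (norm (w j \<omega> - X n))\<^sup>2 \<le> \<Phi> j (X n) \<omega>"
      using \<alpha> by (simp add: lyapunov_def)
    also have "\<dots> < (1 - \<alpha>) / p * (e / 2)\<^sup>2"
      using n[of "j - n"] that m by simp
    finally have "(norm (w j \<omega> - X n))\<^sup>2 < (e / 2)\<^sup>2"
      using pos by (simp only: mult_less_cancel_left_pos)
    then show ?thesis
      using e power_less_imp_less_base[of "norm (w j \<omega> - X n)" 2 "e / 2"] by (simp add: dist_norm)
  qed
  show "\<exists>N. \<forall>i\<ge>N. \<forall>j\<ge>N. dist (w i \<omega>) (w j \<omega>) < e"
    using close by (meson dist_triangle_half_l)
qed

lemma AE_iterates_converge:
  assumes nonempty: "solution_set F G \<noteq> {}"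
  shows "AE \<omega> in M. \<exists>x\<in>solution_set F G. (\<lambda>k. z k \<omega>) \<longlonglongrightarrow> x"
proof -
  have "\<exists>P. P \<in> borel_measurable borel \<and> (\<forall>y. P y \<in> solution_set F G) \<and>
      (\<forall>y. dist y (P y) < infdist y (solution_set F G) + 1 / real (Suc n))" for n
  proof -
    have "0 < 1 / real (Suc n)" by simp
    from measurable_near_projection[OF nonempty this]
    obtain P where "P \<in> borel_measurable borel" "\<And>y. P y \<in> solution_set F G"
      "\<And>y. dist y (P y) < infdist y (solution_set F G) + 1 / real (Suc n)" by blast
    then show ?thesis by blast
  qed
  then obtain P where P [measurable]: "\<And>n. P n \<in> borel_measurable borel"
    and P_sol: "\<And>n y. P n y \<in> solution_set F G"
    and P_near: "\<And>n y. dist y (P n y) < infdist y (solution_set F G) + 1 / real (Suc n)"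
    by metis
  define X where "X n \<omega> = P n (w n \<omega>)" for n \<omega>
  have X: "X n \<in> borel_measurable (past n)" for n
    unfolding X_def by measurable
  obtain x where x: "x \<in> solution_set F G" using nonempty by blast
  have near: "AE \<omega> in M. (\<lambda>n. \<Phi> n (X n \<omega>) \<omega>) \<longlonglongrightarrow> 0"
    using AE_\<Phi>_bounded[OF x] AE_decrease_tendsto_0[OF nonempty] AE_space
  proof eventually_elim
    case (elim \<omega>)
    then obtain m :: nat where m: "\<And>k. \<Phi> k x \<omega> < real m" by blast
    show ?case
      using elim \<Phi>_bounded_imp_w_bounded[OF m] P_near
      by (intro \<Phi>_near_projection_tendsto_0) (auto simp: X_def)
  qed
  \<comment> \<open>The levels \<open>1 / Suc m\<close> are countably many, so one null set serves for all of them.\<close>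
  have "AE \<omega> in M. \<forall>m. \<exists>n. \<forall>k. \<Phi> (n + k) (X n \<omega>) \<omega> < 1 / real (Suc m)"
    unfolding AE_all_countable
    by (intro allI AE_eventually_trapped X near) (auto simp: X_def P_sol)
  then show ?thesis
    using AE_decrease_tendsto_0[OF nonempty] AE_correction_tendsto_0[OF nonempty] AE_space
  proof eventually_elim
    case (elim \<omega>)
    have "Cauchy (\<lambda>k. w k \<omega>)" using elim(1) by (intro w_Cauchy[of "\<lambda>n. X n \<omega>"]) blast
    then obtain y where y: "(\<lambda>k. w k \<omega>) \<longlonglongrightarrow> y"
      using Cauchy_convergent convergent_def by blast
    \<comment> \<open>$z_{k+1}$ is reached from $w_k$ through the half step.\<close>
    have "(\<lambda>k. w k \<omega> - (w k \<omega> - zh k \<omega>) + (z (Suc k) \<omega> - zh k \<omega>)) \<longlonglongrightarrow> y - 0 + 0"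
      by (intro tendsto_intros y elim w_minus_zh_tendsto_0)
    then have "(\<lambda>k. z (Suc k) \<omega>) \<longlonglongrightarrow> y" by simp
    then have "(\<lambda>k. z k \<omega>) \<longlonglongrightarrow> y" by (rule LIMSEQ_imp_Suc)
    moreover have "y \<in> solution_set F G"
      using y by (intro cluster_point_in_solution_set[OF elim(4,2) strict_mono_id]) simp
    ultimately show ?case by blast
  qed
qed

end

theorem theorem4p2:
  fixes M :: "'w measure" and Q :: "'s measure"
    and F :: "'a::euclidean_space \<Rightarrow> 'a" and G :: "'a \<Rightarrow> 'a set"
    and F\<xi> :: "'s \<Rightarrow> 'a \<Rightarrow> 'a"
    and \<alpha> p \<tau> \<gamma> L :: real and z0 :: 'a
    and \<xi> :: "nat \<Rightarrow> 'w \<Rightarrow> 's" and c :: "nat \<Rightarrow> 'w \<Rightarrow> bool"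
    and z zh w :: "nat \<Rightarrow> 'w \<Rightarrow> 'a"
  assumes "prob_space M" and "prob_space Q"
    and "maximally_monotone G" and "maximally_monotone (single_valued_operator F)"
    and "solution_set F G \<noteq> {}"
    and "L > 0" and "lipschitz_in_mean_oracle Q F\<xi> F L"
    and "0 \<le> \<alpha>" and "\<alpha> < 1" and "0 < p" and "p \<le> 1"
    and "0 < \<gamma>" and "\<gamma> < 1" and "\<tau> = sqrt (1 - \<alpha>) / L * \<gamma>"
    and "fbf_randomness M Q p \<xi> c"
    and "fbf_iterates M F\<xi> F G \<alpha> \<tau> z0 \<xi> c z zh w"
  shows "(\<forall>x\<in>solution_set F G. \<forall>k.
            integrable M (lyapunov \<alpha> p z w (Suc k) x) \<and>
            (AE \<omega> in M. real_cond_exp M (fbf_history M Q \<xi> w k) (lyapunov \<alpha> p z w (Suc k) x) \<omega>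
               \<le> lyapunov \<alpha> p z w k x \<omega>)) \<and>
         ((\<forall>s\<in>space Q. continuous_on UNIV (F\<xi> s)) \<longrightarrow>
            (AE \<omega> in M. \<exists>x\<in>solution_set F G. (\<lambda>k. z k \<omega>) \<longlonglongrightarrow> x))"
proof -
  interpret prob_space M by fact
  interpret Q: prob_space Q by fact
  interpret fbf M Q F\<xi> F L G \<alpha> p \<tau> \<gamma> z0 \<xi> c z zh w
    by unfold_locales (use assms in auto)
  show ?thesis
    using \<Phi>_integrable \<Phi>_cond_exp_le AE_iterates_converge[OF assms(5)] by blast
qed

end
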